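(* Let $(\lambda_k,v_k)$, $\lambda_k\to\lambda_0\ge0$, be a sequence of solutions of $$-\Delta v=\lambda\int_{[-1,1]}\frac{\alpha e^{\alpha v}}{\iint_{[-1,1]\times\Omega}e^{\alpha' v}\,\mathcal P(d\alpha')dx}\,\mathcal P(d\alpha)\ \text{ in }\Omega,\qquad v=0\ \text{ on }\partial\Omega$$ (with $\lambda=\lambda_k$, $v=v_k$), and suppose that the concentration alternative $\limsup_{k\to\infty}\|v_k\|_\infty=\infty$, $\mathcal S\neq\emptyset$, occurs (a subsequence being taken as described in the context). Then, for every $x_0\in\mathcal S$, $$\nabla_x\left.\left[H(x,x_0)+\sum_{x_0'\in\mathcal S\setminus\{x_0\}}\frac{m_+(x_0')-m_-(x_0')}{m_+(x_0)-m_-(x_0)}\,G(x,x_0')\right]\right|_{x=x_0}=0.$$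
   Context: $\Omega\subset\mathbf R^2$ is a bounded domain with smooth boundary; $\lambda_k>0$; $\mathcal P$ is a Borel probability measure on $[-1,1]$. Solutions $v_k$ are classical. Blowup sets: $\mathcal S_\pm=\{x_0\in\overline\Omega:\ \text{there exist }x_k\in\Omega\text{ with }x_k\to x_0\text{ and }v_k(x_k)\to\pm\infty\}$, $\mathcal S=\mathcal S_+\cup\mathcal S_-$. Masses: let $I_+=[0,1]$, $I_-=[-1,0)$ and define the measures (with the indicated densities with respect to $dx$) $$\nu_{k,\pm}=\lambda_k\int_{I_\pm}\frac{|\alpha|e^{\alpha v_k}}{\iint_{[-1,1]\times\Omega}e^{\alpha'v_k}\,\mathcal P(d\alpha')dx}\,\mathcal P(d\alpha)$$ on $\overline\Omega$. Their total masses are bounded by $\lambda_k$; after passing to a subsequence $\nu_{k,\pm}$ converge weakly-$*$ in the space $\mathcal M(\overline\Omega)$ of measures to limits $\nu_\pm$, and $m_\pm(x_0)=\nu_\pm(\{x_0\})$ for $x_0\in\mathcal S$. In the concentration alternative, along a suitable subsequence (to which $\mathcal S$ and $m_\pm$ refer), $\mathcal S$ is a nonempty finite subset of $\Omega$ (no boundary points), $v_k\to\sum_{x_0'\in\mathcal S}(m_+(x_0')-m_-(x_0'))G(\cdot,x_0')$ in $C^2_{loc}(\Omega\setminus\mathcal S)$, and for each $x_0\in\mathcal S$ the relation $(m_+(x_0)-m_-(x_0))^2=8\pi(\beta_+(x_0)m_+(x_0)+\beta_-(x_0)m_-(x_0))$ holds, where $\alpha_-^*=\min\operatorname{supp}\mathcal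 P$, $\alpha_+^*=\max\operatorname{supp}\mathcal P$, $\beta_\pm(x_0)=|\alpha_\pm^*|^{-1}$ if $x_0\in\mathcal S_\pm$ and $0$ otherwise; in particular $m_+(x_0)\ne m_-(x_0)$. $G$ is the Green function: $-\Delta G(\cdot,y)=\delta_y$ in $\Omega$, $G(\cdot,y)=0$ on $\partial\Omega$; its regular part is $H(x,y)=G(x,y)-\frac1{2\pi}\log\frac1{|x-y|}$ (extended smoothly to $x=y$). *)

theory Defs
  imports "HOL-Probability.Probability"
begin

section \<open>Differentiability classes on open sets\<close>

definition partial :: "'n::finite \<Rightarrow> (real^'n \<Rightarrow> real) \<Rightarrow> real^'n \<Rightarrow> real" where
  "partial i f x = frechet_derivative f (at x) (axis i 1)"

definition laplacian :: "(real^'n::finite \<Rightarrow> real) \<Rightarrow> real^'n \<Rightarrow> real" where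
  "laplacian f x = (\<Sum>i\<in>UNIV. partial i (partial i f) x)"

text \<open>The class \<open>C\<^sup>k(U)\<close>, meant for open \<open>U\<close> only.\<close>

primrec Ck_on :: "nat \<Rightarrow> (real^'n::finite \<Rightarrow> real) \<Rightarrow> (real^'n) set \<Rightarrow> bool" where
  "Ck_on 0 f U \<longleftrightarrow> continuous_on U f"
| "Ck_on (Suc k) f U \<longleftrightarrow>
     (\<forall>x\<in>U. f differentiable (at x)) \<and> (\<forall>i. Ck_on k (partial i f) U)"

definition smooth_on :: "(real^'n::finite \<Rightarrow> real) \<Rightarrow> (real^'n) set \<Rightarrow> bool" where
  "smooth_on f U \<longleftrightarrow> (\<forall>k. Ck_on k f U)"

definition test_function :: "(real^'n::finite) set \<Rightarrow> (real^'n \<Rightarrow> real) \<Rightarrow> bool" where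
  "test_function \<Omega> \<phi> \<longleftrightarrow>
     smooth_on \<phi> UNIV \<and> (\<exists>K. compact K \<and> K \<subseteq> \<Omega> \<and> (\<forall>x. x \<notin> K \<longrightarrow> \<phi> x = 0))"

definition C2_loc_convergent ::
  "(real^'n::finite) set \<Rightarrow> (nat \<Rightarrow> real^'n \<Rightarrow> real) \<Rightarrow> (real^'n \<Rightarrow> real) \<Rightarrow> bool" where
  "C2_loc_convergent U f g \<longleftrightarrow>
     (\<forall>k. Ck_on 2 (f k) U) \<and> Ck_on 2 g U \<and>
     (\<forall>K. compact K \<and> K \<subseteq> U \<longrightarrow>
        uniform_limit K f g sequentially \<and>
        (\<forall>i. uniform_limit K (\<lambda>k. partial i (f k)) (partial i g) sequentially) \<and>
        (\<forall>i j. uniform_limit K (\<lambda>k. partial i (partial j (f k)))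
                  (partial i (partial j g)) sequentially))"


section \<open>Domains and Green functions\<close>

text \<open>The boundary is smooth if, near each of its points, the domain is a sublevel set
  of a smooth function with nonvanishing gradient.\<close>

definition smooth_boundary :: "(real^'n::finite) set \<Rightarrow> bool" where
  "smooth_boundary \<Omega> \<longleftrightarrow>
     (\<forall>p\<in>frontier \<Omega>. \<exists>U \<rho>. open U \<and> p \<in> U \<and> smooth_on \<rho> U \<and>
        (\<forall>x\<in>U. \<exists>i. partial i \<rho> x \<noteq> 0) \<and> \<Omega> \<inter> U = {x\<in>U. \<rho> x < 0})"

definition bounded_smooth_domain :: "(real^'n::finite) set \<Rightarrow> bool" where
  "bounded_smooth_domain \<Omega> \<longleftrightarrow>
     open \<Omega> \<and> connected \<Omega> \<and> \<Omega> \<noteq> {} \<and> bounded \<Omega> \<and> smooth_boundary \<Omega>"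

text \<open>The equation \<open>-\<Delta> G(\<cdot>, y) = \<delta>\<^sub>y\<close> is understood in the sense of distributions on \<open>\<Omega>\<close>.
  The value \<open>G y y\<close> is irrelevant.\<close>

definition green_function :: "(real^2) set \<Rightarrow> (real^2 \<Rightarrow> real^2 \<Rightarrow> real) \<Rightarrow> bool" where
  "green_function \<Omega> G \<longleftrightarrow>
     (\<forall>y\<in>\<Omega>.
        set_integrable lborel \<Omega> (\<lambda>x. G x y) \<and>
        (\<forall>\<phi>. test_function \<Omega> \<phi> \<longrightarrow>
           - (LINT x:\<Omega>|lborel. G x y * laplacian \<phi> x) = \<phi> y) \<and>
        continuous_on (closure \<Omega> - {y}) (\<lambda>x. G x y) \<and>
        (\<forall>x\<in>frontier \<Omega>. G x y = 0))"

text \<open>The smoothness requirement fixes the value of \<open>H\<close> on the diagonal, where the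
  formula is not imposed.\<close>

definition regular_part ::
  "(real^2) set \<Rightarrow> (real^2 \<Rightarrow> real^2 \<Rightarrow> real) \<Rightarrow> (real^2 \<Rightarrow> real^2 \<Rightarrow> real) \<Rightarrow> bool" where
  "regular_part \<Omega> G H \<longleftrightarrow>
     (\<forall>y\<in>\<Omega>. smooth_on (\<lambda>x. H x y) \<Omega> \<and>
        (\<forall>x\<in>\<Omega> - {y}. H x y = G x y - 1 / (2 * pi) * ln (1 / norm (x - y))))"


section \<open>The mean field equation\<close>

definition borel_probability_on_interval :: "real measure \<Rightarrow> bool" where
  "borel_probability_on_interval P \<longleftrightarrow>
     prob_space P \<and> sets P = sets (restrict_space borel {-1..1})"

definition partition_integral :: "(real^2) set \<Rightarrow> real measure \<Rightarrow> (real^2 \<Rightarrow> real) \<Rightarrow> real" where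
  "partition_integral \<Omega> P v =
     (LINT z|(P \<Otimes>\<^sub>M restrict_space lborel \<Omega>). exp (fst z * v (snd z)))"

definition classical_solution ::
  "(real^2) set \<Rightarrow> real measure \<Rightarrow> real \<Rightarrow> (real^2 \<Rightarrow> real) \<Rightarrow> bool" where
  "classical_solution \<Omega> P lam v \<longleftrightarrow>
     Ck_on 2 v \<Omega> \<and> continuous_on (closure \<Omega>) v \<and>
     (\<forall>x\<in>\<Omega>. - laplacian v x =
        lam * (LINT \<alpha>|P. \<alpha> * exp (\<alpha> * v x) / partition_integral \<Omega> P v)) \<and>
     (\<forall>x\<in>frontier \<Omega>. v x = 0)"


section \<open>Blowup sets and masses\<close>

definition blowup_plus :: "(real^2) set \<Rightarrow> (nat \<Rightarrow> real^2 \<Rightarrow> real) \<Rightarrow> (real^2) set" where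
  "blowup_plus \<Omega> v = {x0 \<in> closure \<Omega>. \<exists>x. (\<forall>k. x k \<in> \<Omega>) \<and> x \<longlonglongrightarrow> x0 \<and>
     filterlim (\<lambda>k. v k (x k)) at_top sequentially}"

definition blowup_minus :: "(real^2) set \<Rightarrow> (nat \<Rightarrow> real^2 \<Rightarrow> real) \<Rightarrow> (real^2) set" where
  "blowup_minus \<Omega> v = {x0 \<in> closure \<Omega>. \<exists>x. (\<forall>k. x k \<in> \<Omega>) \<and> x \<longlonglongrightarrow> x0 \<and>
     filterlim (\<lambda>k. v k (x k)) at_bot sequentially}"

definition blowup_set :: "(real^2) set \<Rightarrow> (nat \<Rightarrow> real^2 \<Rightarrow> real) \<Rightarrow> (real^2) set" where
  "blowup_set \<Omega> v = blowup_plus \<Omega> v \<union> blowup_minus \<Omega> v"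

text \<open>The measure on \<open>closure \<Omega>\<close> below is \<open>\<nu>\<^sub>k\<^sub>,\<^sub>+\<close> for \<open>I = {0..1}\<close> and
  \<open>\<nu>\<^sub>k\<^sub>,\<^sub>-\<close> for \<open>I = {-1..<0}\<close>.\<close>

definition mass_measure ::
  "(real^2) set \<Rightarrow> real measure \<Rightarrow> real set \<Rightarrow> real \<Rightarrow> (real^2 \<Rightarrow> real) \<Rightarrow> (real^2) measure" where
  "mass_measure \<Omega> P I lam v =
     density (restrict_space lborel (closure \<Omega>))
       (\<lambda>x. ennreal (lam *
          (LINT \<alpha>:I|P. \<bar>\<alpha>\<bar> * exp (\<alpha> * v x) / partition_integral \<Omega> P v)))"

definition weak_star_convergent ::
  "'a::topological_space set \<Rightarrow> (nat \<Rightarrow> 'a measure) \<Rightarrow> 'a measure \<Rightarrow> bool" where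
  "weak_star_convergent X M N \<longleftrightarrow>
     finite_measure N \<and> sets N = sets (restrict_space borel X) \<and>
     (\<forall>\<phi> :: 'a \<Rightarrow> real. continuous_on X \<phi> \<longrightarrow>
        (\<lambda>k. integral\<^sup>L (M k) \<phi>) \<longlonglongrightarrow> integral\<^sup>L N \<phi>)"

definition measure_support :: "'a::topological_space measure \<Rightarrow> 'a set" where
  "measure_support M =
     {a \<in> space M. \<forall>U. open U \<and> a \<in> U \<longrightarrow> emeasure M (U \<inter> space M) > 0}"

text \<open>The support of a probability measure on \<open>[-1,1]\<close> is nonempty and compact, so the
  minimum and the maximum exist.\<close>

definition alpha_min :: "real measure \<Rightarrow> real" where
  "alpha_min P = (LEAST a. a \<in> measure_support P)"

definition alpha_max :: "real measure \<Rightarrow> real" where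
  "alpha_max P = (GREATEST a. a \<in> measure_support P)"

definition beta_plus ::
  "(real^2) set \<Rightarrow> real measure \<Rightarrow> (nat \<Rightarrow> real^2 \<Rightarrow> real) \<Rightarrow> real^2 \<Rightarrow> real" where
  "beta_plus \<Omega> P v x0 = (if x0 \<in> blowup_plus \<Omega> v then inverse \<bar>alpha_max P\<bar> else 0)"

definition beta_minus ::
  "(real^2) set \<Rightarrow> real measure \<Rightarrow> (nat \<Rightarrow> real^2 \<Rightarrow> real) \<Rightarrow> real^2 \<Rightarrow> real" where
  "beta_minus \<Omega> P v x0 = (if x0 \<in> blowup_minus \<Omega> v then inverse \<bar>alpha_min P\<bar> else 0)"

end

theory Submission
  imports Defs
begin

text \<open>The theorem says that the forces acting on each blowup point balance. It follows from a
  translational Pohozaev identity, localised to an annulus around the blowup point so that only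
  the convergence of the solutions away from the blowup set is needed.

  Fix a blowup point \<open>a\<close>, put \<open>y = x - a\<close>, and let \<open>v\<close> solve \<open>- \<Delta>v = f(v)\<close> near \<open>a\<close> with \<open>F' = f\<close>. The
  stress tensor \<open>\<nabla>v \<otimes> \<nabla>v - \<bar>\<nabla>v\<bar>\<^sup>2/2 I + F(v) I\<close> is divergence free. Testing it with a radial cutoff
  function that is constant near \<open>a\<close> gives an integral over an annulus. The term with \<open>F(v)\<close>,
  which depends on the unknown normalising factors, is eliminated by one more integration by
  parts, along circles: the angular derivative of \<open>F(v)\<close> is \<open>- \<Delta>v\<close> times that of \<open>v\<close>. The result,
  \<open>pohozaev_identity\<close>, expresses that the integral of a polynomial in \<open>y\<close> and the first and second
  derivatives of \<open>v\<close> against a radial weight vanishes, and this survives \<open>C\<^sup>2\<close> convergence on the annulus.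

  The limit has the form \<open>V = h + c log (1/\<bar>y\<bar>)\<close> with \<open>h\<close> of class \<open>C\<^sup>2\<close> near \<open>a\<close> and \<open>c \<noteq> 0\<close>. Inserting this
  (\<open>pohozaev_density_log_shift\<close>), the contribution of the logarithm alone is odd and integrates to
  zero, and the mixed contribution is \<open>- c \<partial>\<^sub>i h\<close>. The remaining terms involve \<open>h\<close> alone and are
  continuous and zero at \<open>a\<close>. So the average of \<open>- c \<partial>\<^sub>i h + o(1)\<close> over arbitrarily small annuli
  vanishes, which forces \<open>\<partial>\<^sub>i h a = 0\<close> (\<open>regular_gradient_zero\<close>). Finally \<open>h\<close> is the bracket of the theorem
  multiplied by \<open>m\<^sub>+(a) - m\<^sub>-(a) \<noteq> 0\<close>.\<close>

section \<open>Partial derivatives along coordinate lines\<close>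

text \<open>Integration by parts and Schwarz's theorem only involve one direction at a time. Differentiating
  along coordinate lines turns every computation with partial derivatives into one-variable
  calculus.\<close>

definition has_partial ::
  "'n::finite \<Rightarrow> (real^'n \<Rightarrow> real) \<Rightarrow> real \<Rightarrow> real^'n \<Rightarrow> bool" where
  "has_partial i f D x \<longleftrightarrow> ((\<lambda>t. f (x + t *\<^sub>R axis i 1)) has_real_derivative D) (at 0)"

lemma has_partial_along_line:
  assumes "has_partial i f D (x + s *\<^sub>R axis i 1)"
  shows "((\<lambda>t. f (x + t *\<^sub>R axis i 1)) has_real_derivative D) (at s)"
  using assms DERIV_shift[of "\<lambda>t. f (x + t *\<^sub>R axis i 1)" D 0 s]
  by (simp add: has_partial_def algebra_simps)

lemma has_derivative_imp_has_partial:
  assumes "(f has_derivative f') (at x)"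
  shows "has_partial i f (f' (axis i 1)) x"
proof -
  interpret f': bounded_linear f' using assms by (rule has_derivative_bounded_linear)
  have "((\<lambda>t. x + t *\<^sub>R axis i 1) has_derivative (\<lambda>t. t *\<^sub>R axis i 1)) (at (0::real))"
    by (auto intro!: derivative_eq_intros)
  then have "((\<lambda>t. f (x + t *\<^sub>R axis i 1)) has_derivative (\<lambda>t. f' (t *\<^sub>R axis i 1))) (at 0)"
    by (rule has_derivative_compose) (use assms in simp)
  then show ?thesis
    by (simp add: has_partial_def has_field_derivative_def f'.scaleR mult_commute_abs)
qed

lemma partial_eqI: "(f has_derivative f') (at x) \<Longrightarrow> partial i f x = f' (axis i 1)"
  unfolding partial_def using frechet_derivative_at by metis

lemma has_partial_partial: "f differentiable (at x) \<Longrightarrow> has_partial i f (partial i f x) x"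
  unfolding partial_def by (rule has_derivative_imp_has_partial) (simp add: frechet_derivative_works)

lemma has_partial_transform_open:
  assumes "has_partial i f D x" "open U" "x \<in> U" "\<And>y. y \<in> U \<Longrightarrow> f y = g y"
  shows "has_partial i g D x"
proof -
  have "open ((\<lambda>t. x + t *\<^sub>R axis i (1::real)) -` U)"
    by (rule open_vimage[OF assms(2)]) (intro continuous_intros)
  then show ?thesis
    using assms unfolding has_partial_def
    by (auto intro: has_field_derivative_transform_within_open)
qed

lemma integrable_compact_support:
  fixes f :: "'a::euclidean_space \<Rightarrow> real"
  assumes "compact K" "continuous_on K f" "\<And>x. x \<notin> K \<Longrightarrow> f x = 0"
  shows "integrable lborel f"
proof -
  have "(\<lambda>x. indicator K x *\<^sub>R f x) = f"
    using assms(3) by (auto simp: indicator_def fun_eq_iff)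
  with borel_integrable_compact[OF assms(1,2)] show ?thesis by simp
qed

text \<open>Difference quotients of \<open>g\<close> have integral zero because Lebesgue measure is translation
  invariant. They converge to \<open>D\<close> and, by the mean value theorem, are dominated by a constant on a
  compact set. The open set \<open>U\<close> only has to contain the support, so products with functions
  defined on a domain can be integrated by parts.\<close>

lemma has_bochner_integral_partial_zero:
  fixes g D :: "real^'n::finite \<Rightarrow> real"
  assumes U: "open U" and K: "compact K" "K \<subseteq> U"
    and g: "continuous_on U g" "\<And>x. x \<notin> K \<Longrightarrow> g x = 0"
    and D: "continuous_on U D" "\<And>x. x \<notin> K \<Longrightarrow> D x = 0"
    and der: "\<And>x. x \<in> U \<Longrightarrow> has_partial i g (D x) x"
  shows "has_bochner_integral lborel D 0"
proof -
  define e :: "real^'n" where "e = axis i 1"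
  have opn: "open (- K)" using K(1) by (simp add: compact_imp_closed open_Compl)
  have UK: "U \<union> - K = UNIV" using K by auto
  have extend: "continuous_on UNIV f" if "continuous_on U f" "\<And>x. x \<notin> K \<Longrightarrow> f x = 0"
    for f :: "real^'n \<Rightarrow> real"
  proof -
    have "continuous_on (- K) f \<longleftrightarrow> continuous_on (- K) (\<lambda>_. 0::real)"
      by (rule continuous_on_cong) (use that in auto)
    then have "continuous_on (U \<union> - K) f"
      by (intro continuous_on_open_Un U opn that) simp
    then show ?thesis by (simp add: UK)
  qed
  have gc: "continuous_on UNIV g" and Dc: "continuous_on UNIV D"
    by (auto intro!: extend g D)
  have der': "has_partial i g (D x) x" for x
  proof (cases "x \<in> U")
    case False
    then have x: "x \<notin> K" using K by auto
    have "has_partial i (\<lambda>_. 0) (D x) x"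
      using D(2)[OF x] by (simp add: has_partial_def)
    then show ?thesis
      by (rule has_partial_transform_open[OF _ opn]) (use x g in auto)
  qed (rule der)
  have "bounded (D ` K)"
    by (intro compact_imp_bounded compact_continuous_image K continuous_on_subset[OF Dc]) auto
  then obtain M where M: "M > 0" "\<And>x. x \<in> K \<Longrightarrow> \<bar>D x\<bar> \<le> M"
    unfolding bounded_pos by auto
  have MD: "\<bar>D x\<bar> \<le> M" for x using M D(2)[of x] by (cases "x \<in> K") auto
  define h :: "nat \<Rightarrow> real" where "h n = 1 / Suc n" for n
  have h: "0 < h n" "h n \<le> 1" for n by (auto simp: h_def divide_simps)
  define q where "q n x = (g (x + h n *\<^sub>R e) - g x) / h n" for n x
  define K' where "K' = (\<lambda>(y, t). y - t *\<^sub>R e) ` (K \<times> {0..1})"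
  have K': "compact K'" unfolding K'_def
    by (intro compact_continuous_image compact_Times K compact_Icc)
       (auto simp: case_prod_beta intro!: continuous_intros)
  have g_int: "integrable lborel g" and D_int: "integrable lborel D"
    by (rule integrable_compact_support[OF K(1)]; use g D gc Dc in
        \<open>auto intro: continuous_on_subset\<close>)+
  have gm: "g \<in> borel_measurable borel" and Dm: "D \<in> borel_measurable borel"
    using gc Dc by (auto intro: borel_measurable_continuous_onI)
  have shift: "integrable lborel (\<lambda>x. g (x + c))"
    "integral\<^sup>L lborel (\<lambda>x. g (x + c)) = integral\<^sup>L lborel g" for c
  proof -
    have "integrable (distr lborel borel ((+) c)) g" using g_int by (simp add: lborel_distr_plus)
    then show "integrable lborel (\<lambda>x. g (x + c))"
      by (subst (asm) integrable_distr_eq) (use gm in \<open>auto simp: add.commute\<close>)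
    have "integral\<^sup>L (distr lborel borel ((+) c)) g = integral\<^sup>L lborel (\<lambda>x. g (c + x))"
      by (rule integral_distr) (use gm in auto)
    then show "integral\<^sup>L lborel (\<lambda>x. g (x + c)) = integral\<^sup>L lborel g"
      by (simp add: lborel_distr_plus add.commute)
  qed
  have q0: "integral\<^sup>L lborel (q n) = 0" for n
    unfolding q_def by (simp add: shift g_int)
  have "(\<lambda>n. integral\<^sup>L lborel (q n)) \<longlonglongrightarrow> integral\<^sup>L lborel D"
  proof (rule integral_dominated_convergence[where w="\<lambda>x. M * indicator K' x"])
    show "D \<in> borel_measurable lborel" using Dm by simp
    show "q n \<in> borel_measurable lborel" for n
      unfolding q_def using gm by measurable
    show "integrable lborel (\<lambda>x. M * indicator K' x)"
      using borel_integrable_compact[OF K', of "\<lambda>_. M"] by (simp add: mult.commute)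
    show "AE x in lborel. (\<lambda>n. q n x) \<longlonglongrightarrow> D x"
    proof (rule AE_I2)
      fix x
      have "((\<lambda>t. (g (x + t *\<^sub>R e) - g x) / t) \<longlongrightarrow> D x) (at 0)"
        using der'[of x] by (simp add: has_partial_def e_def DERIV_def)
      moreover have "h \<longlonglongrightarrow> 0"
        using LIMSEQ_inverse_real_of_nat by (simp add: h_def[abs_def] inverse_eq_divide)
      then have "filterlim h (at 0) sequentially"
        unfolding filterlim_at using h by (auto simp: less_imp_neq[THEN not_sym])
      ultimately show "(\<lambda>n. q n x) \<longlonglongrightarrow> D x"
        unfolding q_def by (rule filterlim_compose)
    qed
    show "AE x in lborel. norm (q n x) \<le> M * indicator K' x" for n
    proof (rule AE_I2)
      fix x
      have "\<exists>z. 0 < z \<and> z < h n \<and>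
          g (x + h n *\<^sub>R e) - g (x + 0 *\<^sub>R e) = (h n - 0) * D (x + z *\<^sub>R e)"
        by (rule MVT2) (auto intro!: has_partial_along_line der' h simp: e_def)
      then obtain z where z: "0 < z" "z < h n" "q n x = D (x + z *\<^sub>R e)"
        using h(1)[of n] by (auto simp: q_def field_simps)
      show "norm (q n x) \<le> M * indicator K' x"
      proof (cases "x \<in> K'")
        case True then show ?thesis using z MD by simp
      next
        case False
        have "x + z *\<^sub>R e \<notin> K"
        proof
          assume "x + z *\<^sub>R e \<in> K"
          then have "(x + z *\<^sub>R e, z) \<in> K \<times> {0..1}" using z h(2)[of n] by auto
          then have "x \<in> K'" unfolding K'_def by (rule rev_image_eqI) simp
          with False show False ..
        qed
        then show ?thesis using False z D(2) by simp
      qed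
    qed
  qed
  then show ?thesis using D_int by (simp add: q0 LIMSEQ_const_iff has_bochner_integral_iff)
qed

text \<open>The second difference of \<open>u\<close> over a small square is symmetric in the two directions, and the
  mean value theorem, applied in either order, expresses it through either mixed derivative at a
  point of the square. Shrinking the square gives equality at \<open>x\<close> by continuity.\<close>

lemma mixed_partials_eq:
  fixes u :: "real^'n::finite \<Rightarrow> real"
  assumes U: "open U" "x \<in> U"
    and ui: "\<And>y. y \<in> U \<Longrightarrow> has_partial i u (p y) y"
    and uj: "\<And>y. y \<in> U \<Longrightarrow> has_partial j u (q y) y"
    and uij: "\<And>y. y \<in> U \<Longrightarrow> has_partial j p (pj y) y"
    and uji: "\<And>y. y \<in> U \<Longrightarrow> has_partial i q (qi y) y"
    and cont: "continuous_on U pj" "continuous_on U qi"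
  shows "pj x = qi x"
proof -
  \<comment> \<open>Stated for arbitrary directions \<open>k\<close>, \<open>l\<close> since it is needed for both orders.\<close>
  have second_difference: "\<exists>\<xi> \<eta>. \<xi> \<in> {0<..<t} \<and> \<eta> \<in> {0<..<t} \<and>
      u (x + t *\<^sub>R axis k 1 + t *\<^sub>R axis l 1) - u (x + t *\<^sub>R axis k 1) - u (x + t *\<^sub>R axis l 1) + u x
      = t * t * ab (x + \<xi> *\<^sub>R axis k 1 + \<eta> *\<^sub>R axis l 1)"
    if t: "0 < t" and sub: "\<And>a b. a \<in> {0..t} \<Longrightarrow> b \<in> {0..t} \<Longrightarrow>
        x + a *\<^sub>R axis k 1 + b *\<^sub>R axis l 1 \<in> U"
      and a: "\<And>y. y \<in> U \<Longrightarrow> has_partial k u (a y) y"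
      and ab: "\<And>y. y \<in> U \<Longrightarrow> has_partial l a (ab y) y"
    for t k l a ab
  proof -
    let ?f = "\<lambda>s. u (x + t *\<^sub>R axis l 1 + s *\<^sub>R axis k 1) - u (x + s *\<^sub>R axis k 1)"
    have "\<exists>z. 0 < z \<and> z < t \<and> ?f t - ?f 0 =
        (t - 0) * (a (x + t *\<^sub>R axis l 1 + z *\<^sub>R axis k 1) - a (x + z *\<^sub>R axis k 1))"
    proof (rule MVT2[OF t])
      fix s assume "0 \<le> s" "s \<le> t"
      then have 1: "x + t *\<^sub>R axis l 1 + s *\<^sub>R axis k 1 \<in> U" "x + s *\<^sub>R axis k 1 \<in> U"
        using sub[of s t] sub[of s 0] t by (auto simp: algebra_simps)
      show "(?f has_real_derivative a (x + t *\<^sub>R axis l 1 + s *\<^sub>R axis k 1)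
          - a (x + s *\<^sub>R axis k 1)) (at s)"
        by (intro DERIV_diff has_partial_along_line a 1)
    qed
    then obtain \<xi> where \<xi>: "0 < \<xi>" "\<xi> < t" "?f t - ?f 0 =
        t * (a (x + t *\<^sub>R axis l 1 + \<xi> *\<^sub>R axis k 1) - a (x + \<xi> *\<^sub>R axis k 1))" by auto
    let ?y = "x + \<xi> *\<^sub>R axis k 1"
    have "\<exists>z. 0 < z \<and> z < t \<and> a (?y + t *\<^sub>R axis l 1) - a (?y + 0 *\<^sub>R axis l 1) =
        (t - 0) * ab (?y + z *\<^sub>R axis l 1)"
      by (rule MVT2[OF t]) (use \<xi> in \<open>auto intro!: has_partial_along_line ab sub\<close>)
    then obtain \<eta> where \<eta>: "0 < \<eta>" "\<eta> < t"
        "a (?y + t *\<^sub>R axis l 1) - a ?y = t * ab (?y + \<eta> *\<^sub>R axis l 1)" by auto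
    have "?f t - ?f 0 = t * (t * ab (?y + \<eta> *\<^sub>R axis l 1))"
      using \<xi>(3) \<eta>(3) by (simp add: algebra_simps)
    then show ?thesis using \<xi> \<eta>
      by (intro exI[of _ \<xi>] exI[of _ \<eta>]) (auto simp: algebra_simps)
  qed
  show ?thesis
  proof (rule ccontr)
    assume ne: "pj x \<noteq> qi x"
    define \<epsilon> where "\<epsilon> = \<bar>pj x - qi x\<bar> / 2"
    have \<epsilon>: "\<epsilon> > 0" using ne by (simp add: \<epsilon>_def)
    have "continuous (at x) pj" "continuous (at x) qi"
      using cont U continuous_on_eq_continuous_at by blast+
    then have "\<exists>d>0. \<forall>y. dist y x < d \<longrightarrow> \<bar>pj y - pj x\<bar> < \<epsilon>"
      "\<exists>d>0. \<forall>y. dist y x < d \<longrightarrow> \<bar>qi y - qi x\<bar> < \<epsilon>"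
      using \<epsilon> unfolding continuous_at_eps_delta dist_real_def by blast+
    then obtain d1 d2 where d: "d1 > 0" "\<And>y. dist y x < d1 \<Longrightarrow> \<bar>pj y - pj x\<bar> < \<epsilon>"
      "d2 > 0" "\<And>y. dist y x < d2 \<Longrightarrow> \<bar>qi y - qi x\<bar> < \<epsilon>"
      by blast
    obtain d3 where d3: "d3 > 0" "ball x d3 \<subseteq> U" using U openE by blast
    define t where "t = min d1 (min d2 d3) / 3"
    have t: "0 < t" "2 * t < d1" "2 * t < d2" "2 * t < d3" using d d3 by (auto simp: t_def)
    have near: "dist (x + a *\<^sub>R axis k 1 + b *\<^sub>R axis l 1) x \<le> 2 * t"
      if "a \<in> {0..t}" "b \<in> {0..t}" for a b k l
    proof -
      have "norm (a *\<^sub>R axis k 1 + b *\<^sub>R axis l (1::real)) \<le> norm (a *\<^sub>R axis k (1::real)) + norm (b *\<^sub>R axis l (1::real))"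
        by (rule norm_triangle_ineq)
      then show ?thesis using that by (simp add: dist_norm norm_axis_1 add.assoc)
    qed
    have sub: "x + a *\<^sub>R axis k 1 + b *\<^sub>R axis l 1 \<in> U"
      if "a \<in> {0..t}" "b \<in> {0..t}" for a b k l
    proof -
      have "dist (x + a *\<^sub>R axis k 1 + b *\<^sub>R axis l 1) x < d3"
        using near[OF that, of k l] t(4) by linarith
      then show ?thesis using d3(2) by (auto simp: dist_commute)
    qed
    obtain a b where ab: "a \<in> {0<..<t}" "b \<in> {0<..<t}"
      "u (x + t *\<^sub>R axis i 1 + t *\<^sub>R axis j 1) - u (x + t *\<^sub>R axis i 1) - u (x + t *\<^sub>R axis j 1) + u x
       = t * t * pj (x + a *\<^sub>R axis i 1 + b *\<^sub>R axis j 1)"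
      using second_difference[OF t(1) sub ui uij] by blast
    obtain a' b' where ab': "a' \<in> {0<..<t}" "b' \<in> {0<..<t}"
      "u (x + t *\<^sub>R axis j 1 + t *\<^sub>R axis i 1) - u (x + t *\<^sub>R axis j 1) - u (x + t *\<^sub>R axis i 1) + u x
       = t * t * qi (x + a' *\<^sub>R axis j 1 + b' *\<^sub>R axis i 1)"
      using second_difference[OF t(1) sub uj uji] by blast
    have "t * t * pj (x + a *\<^sub>R axis i 1 + b *\<^sub>R axis j 1) = t * t * qi (x + a' *\<^sub>R axis j 1 + b' *\<^sub>R axis i 1)"
      using ab(3) ab'(3) by (simp add: algebra_simps)
    then have eq: "pj (x + a *\<^sub>R axis i 1 + b *\<^sub>R axis j 1) = qi (x + a' *\<^sub>R axis j 1 + b' *\<^sub>R axis i 1)"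
      using t(1) by simp
    have "\<bar>pj (x + a *\<^sub>R axis i 1 + b *\<^sub>R axis j 1) - pj x\<bar> < \<epsilon>"
      using near[of a b i j] ab t by (intro d) auto
    moreover have "\<bar>qi (x + a' *\<^sub>R axis j 1 + b' *\<^sub>R axis i 1) - qi x\<bar> < \<epsilon>"
      using near[of a' b' j i] ab' t by (intro d) auto
    ultimately show False using eq unfolding \<epsilon>_def by (auto simp: abs_if split: if_splits)
  qed
qed

lemma has_partial_const: "has_partial i (\<lambda>x. c) 0 x"
  by (simp add: has_partial_def)

lemma has_partial_add:
  "has_partial i f D x \<Longrightarrow> has_partial i g E x \<Longrightarrow> has_partial i (\<lambda>x. f x + g x) (D + E) x"
  unfolding has_partial_def by (rule DERIV_add)

lemma has_partial_diff:
  "has_partial i f D x \<Longrightarrow> has_partial i g E x \<Longrightarrow> has_partial i (\<lambda>x. f x - g x) (D - E) x"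
  unfolding has_partial_def by (rule DERIV_diff)

lemma has_partial_mult:
  "has_partial i f D x \<Longrightarrow> has_partial i g E x \<Longrightarrow>
    has_partial i (\<lambda>x. f x * g x) (D * g x + f x * E) x"
  unfolding has_partial_def by (drule (1) DERIV_mult) (simp add: mult.commute)

lemma has_partial_power2:
  "has_partial i f D x \<Longrightarrow> has_partial i (\<lambda>x. (f x)\<^sup>2) (2 * f x * D) x"
  using has_partial_mult[of i f D x f D] by (simp add: power2_eq_square algebra_simps)

lemma has_partial_chain:
  assumes "has_partial i f D x" "(g has_real_derivative E) (at (f x))"
  shows "has_partial i (\<lambda>x. g (f x)) (E * D) x"
  using DERIV_chain2[of g E "\<lambda>t. f (x + t *\<^sub>R axis i 1)" 0 D] assms
  by (simp add: has_partial_def)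

lemma has_partial_coordinate:
  "has_partial i (\<lambda>x. x $ k - a $ k) (if k = i then 1 else 0) x"
  unfolding has_partial_def by (auto intro!: derivative_eq_intros simp: axis_def)

lemma has_partial_sqdist:
  "has_partial i (\<lambda>x. (x - a) \<bullet> (x - a)) (2 * (x $ i - a $ i)) x"
proof -
  have "((\<lambda>x. (x - a) \<bullet> (x - a)) has_derivative (\<lambda>h. (x - a) \<bullet> h + h \<bullet> (x - a))) (at x)"
    by (auto intro!: derivative_eq_intros)
  from has_derivative_imp_has_partial[OF this, of i] show ?thesis
    by (simp add: inner_axis inner_axis' algebra_simps)
qed

lemma has_partial_eq: "has_partial i f D x \<Longrightarrow> D = E \<Longrightarrow> has_partial i f E x"
  by simp

lemmas has_partial_intros = has_partial_const has_partial_add has_partial_diff has_partial_mult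
  has_partial_power2 has_partial_coordinate has_partial_sqdist

section \<open>The classes of continuously differentiable functions\<close>

lemma Ck_on_2D:
  fixes v :: "real^'n::finite \<Rightarrow> real"
  assumes "Ck_on 2 v U"
  shows "x \<in> U \<Longrightarrow> v differentiable (at x)" "x \<in> U \<Longrightarrow> partial i v differentiable (at x)"
    "continuous_on U v" "continuous_on U (partial i v)" "continuous_on U (partial i (partial j v))"
proof -
  have C: "\<forall>x\<in>U. v differentiable (at x)" "\<forall>i. \<forall>x\<in>U. partial i v differentiable (at x)"
    "\<forall>j i. continuous_on U (partial i (partial j v))"
    using assms by (simp_all add: numeral_2_eq_2)
  then show "x \<in> U \<Longrightarrow> v differentiable (at x)" "x \<in> U \<Longrightarrow> partial i v differentiable (at x)"
    "continuous_on U (partial i (partial j v))" by auto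
  have *: "continuous_on U g" if "\<forall>x\<in>U. g differentiable (at x)" for g :: "real^'n \<Rightarrow> real"
    using that by (auto intro: continuous_at_imp_continuous_on differentiable_imp_continuous_within)
  show "continuous_on U v" "continuous_on U (partial i v)"
    using C by (auto intro: *)
qed

lemma partial_cong_open:
  assumes "open U" "x \<in> U" "\<And>y. y \<in> U \<Longrightarrow> f y = g y" "f differentiable (at x)"
  shows "partial i f x = partial i g x"
  unfolding partial_def using frechet_derivative_transform_within_open[OF assms(4,1,2,3)] by simp

lemma Ck_on_cong:
  assumes "open U" "\<And>x. x \<in> U \<Longrightarrow> f x = g x" "Ck_on k f U"
  shows "Ck_on k g U"
  using assms(2,3)
proof (induction k arbitrary: f g)
  case 0
  then show ?case using continuous_on_cong[of U U f g] by simp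
next
  case (Suc k)
  have "g differentiable (at x)" if "x \<in> U" for x
  proof -
    have "(f has_derivative frechet_derivative f (at x)) (at x)"
      using Suc.prems that by (simp add: frechet_derivative_works[symmetric])
    then have "(g has_derivative frechet_derivative f (at x)) (at x)"
      by (rule has_derivative_transform_within_open[OF _ assms(1) that]) (rule Suc.prems)
    then show ?thesis by (auto simp: differentiable_def)
  qed
  moreover have "Ck_on k (partial i g) U" for i
    by (rule Suc.IH[of "partial i f"])
      (use Suc.prems in \<open>auto intro!: partial_cong_open[OF assms(1)]\<close>)
  ultimately show ?case by simp
qed

lemma partial_add:
  "f differentiable (at x) \<Longrightarrow> g differentiable (at x) \<Longrightarrow>
    partial i (\<lambda>x. f x + g x) x = partial i f x + partial i g x"
  unfolding frechet_derivative_works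
  by (drule (1) has_derivative_add, drule partial_eqI) (simp add: partial_def)

lemma partial_cmult:
  "f differentiable (at x) \<Longrightarrow> partial i (\<lambda>x. c * f x) x = c * partial i f x"
  unfolding frechet_derivative_works
  by (drule has_derivative_mult_right, drule partial_eqI) (simp add: partial_def)

lemma Ck_on_add:
  assumes "open U" "Ck_on k f U" "Ck_on k g U"
  shows "Ck_on k (\<lambda>x. f x + g x) U"
  using assms(2,3)
proof (induction k arbitrary: f g)
  case 0
  then show ?case by (auto intro: continuous_on_add)
next
  case (Suc k)
  have "Ck_on k (partial i (\<lambda>x. f x + g x)) U" for i
    by (rule Ck_on_cong[OF assms(1) _ Suc.IH[of "partial i f" "partial i g"]])
      (use Suc.prems in \<open>auto simp: partial_add\<close>)
  then show ?case using Suc.prems by (auto intro: differentiable_add)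
qed

lemma Ck_on_cmult:
  assumes "open U" "Ck_on k f U"
  shows "Ck_on k (\<lambda>x. c * f x) U"
  using assms(2)
proof (induction k arbitrary: f)
  case 0
  then show ?case by (auto intro: continuous_on_mult continuous_on_const)
next
  case (Suc k)
  have "Ck_on k (partial i (\<lambda>x. c * f x)) U" for i
    by (rule Ck_on_cong[OF assms(1) _ Suc.IH[of "partial i f"]])
      (use Suc.prems in \<open>auto simp: partial_cmult\<close>)
  then show ?case using Suc.prems by (auto intro: differentiable_mult differentiable_const)
qed

lemma partial_zero: "partial i (\<lambda>x. 0) x = 0"
  by (rule partial_eqI[where f'="\<lambda>h. 0", simplified]) simp

lemma Ck_on_zero: "Ck_on k (\<lambda>x. 0) U"
proof (induction k)
  case (Suc k)
  have "partial i (\<lambda>x::real^'a. 0) = (\<lambda>x. 0)" for i by (simp add: partial_zero fun_eq_iff)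
  then show ?case using Suc by simp
qed simp

lemma Ck_on_sum:
  assumes "open U" "finite I" "\<And>s. s \<in> I \<Longrightarrow> Ck_on k (f s) U"
  shows "Ck_on k (\<lambda>x. \<Sum>s\<in>I. f s x) U"
  using assms(2,3) by (induction I) (auto intro: Ck_on_zero Ck_on_add[OF assms(1)])

lemma Ck_on_subset: "Ck_on k f U \<Longrightarrow> W \<subseteq> U \<Longrightarrow> Ck_on k f W"
  by (induction k arbitrary: f) (auto intro: continuous_on_subset)

lemma GDERIV_zero_if_partials_zero:
  fixes f :: "real^'n::finite \<Rightarrow> real"
  assumes "f differentiable (at x)" "\<And>i. partial i f x = 0"
  shows "GDERIV f x :> 0"
proof -
  let ?D = "frechet_derivative f (at x)"
  have D: "(f has_derivative ?D) (at x)" using assms(1) by (simp add: frechet_derivative_works)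
  then have lin: "linear ?D" by (rule has_derivative_linear)
  have "?D = (\<lambda>h. 0)"
  proof (rule linear_eq_stdbasis[OF lin])
    show "?D b = 0" if "b \<in> Basis" for b
      using that assms(2) by (auto simp: Basis_vec_def partial_def)
  qed (simp add: linear_zero)
  then show ?thesis using D by (simp add: gderiv_def)
qed

section \<open>Integrals of compactly supported functions\<close>

text \<open>The functions share a compact support, so the error of the integral is at most the uniform
  error times the measure of the support.\<close>

lemma has_bochner_integral_zero_uniform_limit:
  fixes f :: "nat \<Rightarrow> 'a::euclidean_space \<Rightarrow> real"
  assumes K: "compact K" and lim: "uniform_limit K f g sequentially"
    and f: "\<And>k. continuous_on K (f k)" "\<And>k x. x \<notin> K \<Longrightarrow> f k x = 0"
    and g: "\<And>x. x \<notin> K \<Longrightarrow> g x = 0"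
    and zero: "\<And>k. integral\<^sup>L lborel (f k) = 0"
  shows "has_bochner_integral lborel g 0"
proof -
  have gc: "continuous_on K g"
    by (rule uniform_limit_theorem[OF _ lim]) (use f in auto)
  note int = integrable_compact_support[OF K]
  have gi: "integrable lborel g" and fi: "integrable lborel (f k)" for k
    using int[OF gc g] int[OF f] by auto
  have Ki: "integrable lborel (\<lambda>x. c * indicator K x)" for c :: real
    by (rule int) (auto intro!: continuous_intros continuous_on_eq[OF continuous_on_const[of _ c]])
  define I :: real where "I = integral\<^sup>L lborel (indicator K)"
  have I: "I \<ge> 0" unfolding I_def by (rule integral_nonneg_AE) auto
  have "\<bar>integral\<^sup>L lborel g\<bar> \<le> e" if e: "e > 0" for e
  proof -
    define d where "d = e / (I + 1)"
    have d: "d > 0" using e I by (simp add: d_def)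
    have "\<forall>\<^sub>F k in sequentially. \<forall>x\<in>K. dist (f k x) (g x) < d"
      using lim d by (rule uniform_limitD)
    then obtain k where k: "\<And>x. x \<in> K \<Longrightarrow> dist (f k x) (g x) < d"
      by (auto simp: eventually_sequentially)
    have le: "norm (g x - f k x) \<le> d * indicator K x" for x
      using k[of x] g[of x] f(2)[of x k] by (cases "x \<in> K") (auto simp: dist_real_def)
    have "norm (integral\<^sup>L lborel g) = norm (integral\<^sup>L lborel (\<lambda>x. g x - f k x))"
      by (simp add: Bochner_Integration.integral_diff[OF gi fi] zero)
    also have "\<dots> \<le> integral\<^sup>L lborel (\<lambda>x. norm (g x - f k x))"
      by (rule integral_norm_bound)
    also have "\<dots> \<le> integral\<^sup>L lborel (\<lambda>x. d * indicator K x)"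
      by (rule integral_mono[OF _ Ki le]) (use gi fi in auto)
    also have "\<dots> = d * I" by (simp add: I_def)
    also have "\<dots> \<le> e" using e I by (simp add: d_def field_simps)
    finally show ?thesis by simp
  qed
  then have "\<bar>integral\<^sup>L lborel g\<bar> \<le> 0" by (rule field_le_epsilon) simp
  then show ?thesis using gi by (simp add: has_bochner_integral_iff)
qed

lemma uniform_limit_mult_compact:
  fixes f g :: "nat \<Rightarrow> 'a::topological_space \<Rightarrow> real"
  assumes "compact K" "uniform_limit K f l F" "uniform_limit K g m F"
    "continuous_on K l" "continuous_on K m"
  shows "uniform_limit K (\<lambda>k x. f k x * g k x) (\<lambda>x. l x * m x) F"
  by (rule uniform_lim_mult[OF assms(2,3)])
    (intro compact_imp_bounded compact_continuous_image assms)+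

lemma integral_odd_zero:
  fixes f :: "'a::euclidean_space \<Rightarrow> real"
  assumes "f \<in> borel_measurable borel" "\<And>x. f (2 *\<^sub>R a - x) = - f x"
  shows "integral\<^sup>L lborel f = 0"
proof -
  have "distr lborel borel (\<lambda>x. 2 *\<^sub>R a - x) = (lborel :: 'a measure)"
    using lborel_affine[of "-1" "2 *\<^sub>R a"] by (simp add: density_1)
  then have "integral\<^sup>L lborel f = integral\<^sup>L (distr lborel borel (\<lambda>x. 2 *\<^sub>R a - x)) f" by simp
  also have "\<dots> = integral\<^sup>L lborel (\<lambda>x. f (2 *\<^sub>R a - x))"
    by (rule integral_distr) (use assms in auto)
  finally show ?thesis by (simp add: assms(2))
qed

text \<open>Such a function vanishes almost everywhere, and a nonempty open set is not negligible.\<close>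

lemma nonneg_integral_zero_imp_zero_in_open:
  fixes f :: "'a::euclidean_space \<Rightarrow> real"
  assumes "has_bochner_integral lborel f 0" "\<And>x. f x \<ge> 0" "open T" "x \<in> T"
  shows "\<exists>y\<in>T. f y = 0"
proof (rule ccontr)
  assume ne: "\<not> ?thesis"
  have "AE x in lborel. f x = 0"
    using assms(1,2) integral_nonneg_eq_0_iff_AE[of lborel f] by (auto simp: has_bochner_integral_iff)
  then have "AE x in lborel. x \<notin> T" by eventually_elim (use ne in auto)
  then have "AE x in lebesgue. x \<notin> T" by (rule AE_completion)
  then have "negligible T"
    using AE_iff_null_sets[of T lebesgue] assms(3) by (simp add: negligible_iff_null_sets)
  then show False using open_not_negligible assms(3,4) by blast
qed

section \<open>A radial weight supported in an annulus\<close>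

text \<open>A radial weight with argument \<open>t = \<bar>x - a\<bar>\<^sup>2\<close>, supported in the annulus
  \<open>\<epsilon>/2 \<le> t \<le> \<epsilon>\<close>. With \<open>p = (max 0 (t - \<epsilon>/2))^3\<close>, it is a multiple of the derivative of
  \<open>(max 0 ((\<epsilon>/2)^3 - p))^3\<close>, so that it has an explicit primitive that vanishes beyond \<open>\<epsilon>\<close>.\<close>

definition annulus_weight :: "real \<Rightarrow> real \<Rightarrow> real" where
  "annulus_weight \<epsilon> t = (max 0 (t - \<epsilon>/2))\<^sup>2 * (max 0 ((\<epsilon>/2)^3 - (max 0 (t - \<epsilon>/2))^3))\<^sup>2"

lemma annulus_weight_nonneg: "annulus_weight \<epsilon> t \<ge> 0"
  by (simp add: annulus_weight_def)

lemma annulus_weight_eq_0: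
  assumes "\<epsilon> > 0" "t \<le> \<epsilon>/2 \<or> t \<ge> \<epsilon>"
  shows "annulus_weight \<epsilon> t = 0"
proof -
  have "(\<epsilon>/2)^3 \<le> (t - \<epsilon>/2)^3" if "t \<ge> \<epsilon>"
    using assms that by (intro power_mono) auto
  then show ?thesis using assms by (auto simp: annulus_weight_def max_def)
qed

lemma annulus_weight_pos:
  assumes "\<epsilon>/2 < t" "t < \<epsilon>"
  shows "annulus_weight \<epsilon> t > 0"
proof -
  have "(t - \<epsilon>/2)^3 < (\<epsilon>/2)^3" using assms by (intro power_strict_mono) auto
  then show ?thesis using assms by (simp add: annulus_weight_def max_def)
qed

text \<open>The exponent is at least two, which makes the derivatives from both sides agree at 0.\<close>

lemma DERIV_max_0_power:
  "((\<lambda>t::real. (max 0 t) ^ Suc (Suc n)) has_real_derivative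
      real (Suc (Suc n)) * (max 0 t) ^ Suc n) (at t)"
proof -
  consider "t > 0" | "t < 0" | "t = 0" by linarith
  then show ?thesis
  proof cases
    case 1
    have "((\<lambda>t::real. t ^ Suc (Suc n)) has_real_derivative real (Suc (Suc n)) * t ^ Suc n) (at t)"
      using DERIV_pow[of "Suc (Suc n)" t] by simp
    then have "((\<lambda>t::real. (max 0 t) ^ Suc (Suc n)) has_real_derivative
      real (Suc (Suc n)) * t ^ Suc n) (at t)"
      by (rule has_field_derivative_transform_within_open[where S="{0<..}"]) (use 1 in auto)
    then show ?thesis using 1 by simp
  next
    case 2
    have "((\<lambda>t::real. 0) has_real_derivative 0) (at t)" by simp
    then have "((\<lambda>t::real. (max 0 t) ^ Suc (Suc n)) has_real_derivative 0) (at t)"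
      by (rule has_field_derivative_transform_within_open[where S="{..<0}"]) (use 2 in auto)
    then show ?thesis using 2 by simp
  next
    case 3
    have "((\<lambda>h::real. (max 0 h) ^ Suc (Suc n) / h) \<longlongrightarrow> 0) (at 0)"
    proof (rule Lim_transform_eventually)
      have "((\<lambda>h::real. (max 0 h) ^ Suc n) \<longlongrightarrow> (max 0 0) ^ Suc n) (at 0)"
        by (intro tendsto_intros)
      then show "((\<lambda>h::real. (max 0 h) ^ Suc n) \<longlongrightarrow> 0) (at 0)" by simp
      show "\<forall>\<^sub>F h::real in at 0. (max 0 h) ^ Suc n = (max 0 h) ^ Suc (Suc n) / h"
        unfolding eventually_at by (auto intro!: exI[of _ 1] simp: max_def)
    qed
    then show ?thesis using 3 by (simp add: DERIV_def)
  qed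
qed

lemma DERIV_annulus_weight_inner:
  "((\<lambda>t::real. b - (max 0 (t - c))^3) has_real_derivative - (3 * (max 0 (t - c))\<^sup>2)) (at t)"
proof -
  have cube: "((\<lambda>t::real. (max 0 t)^3) has_real_derivative 3 * (max 0 t)\<^sup>2) (at t)" for t
    using DERIV_max_0_power[of 1 t] by (simp add: numeral_3_eq_3 numeral_2_eq_2)
  have "((\<lambda>t. t - c) has_real_derivative 1) (at t)"
    by (auto intro!: derivative_eq_intros)
  from DERIV_diff[OF DERIV_const[of b] DERIV_chain2[OF cube this]] show ?thesis by simp
qed

lemma annulus_weight_C1:
  obtains \<psi>' where "\<And>t. (annulus_weight \<epsilon> has_real_derivative \<psi>' t) (at t)" "continuous_on UNIV \<psi>'"
proof -
  have d2: "((\<lambda>t::real. (max 0 t)\<^sup>2) has_real_derivative 2 * max 0 t) (at t)" for t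
    using DERIV_max_0_power[of 0 t] by (simp add: numeral_2_eq_2)
  let ?c = "\<epsilon>/2"
  let ?u = "\<lambda>t. ?c^3 - (max 0 (t - ?c))^3"
  have shift: "((\<lambda>t. t - ?c) has_real_derivative 1) (at t)" for t
    by (auto intro!: derivative_eq_intros)
  have "(annulus_weight \<epsilon> has_real_derivative
      (2 * max 0 (t - ?c)) * (max 0 (?u t))\<^sup>2 +
      (2 * max 0 (?u t) * - (3 * (max 0 (t - ?c))\<^sup>2)) * (max 0 (t - ?c))\<^sup>2) (at t)" for t
    unfolding annulus_weight_def[abs_def]
    using DERIV_mult[OF DERIV_chain2[OF d2 shift, of t]
        DERIV_chain2[OF d2 DERIV_annulus_weight_inner, of "?c^3" ?c t]] by simp
  moreover have "continuous_on UNIV (\<lambda>t. (2 * max 0 (t - ?c)) * (max 0 (?u t))\<^sup>2 +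
      (2 * max 0 (?u t) * - (3 * (max 0 (t - ?c))\<^sup>2)) * (max 0 (t - ?c))\<^sup>2)"
    by (intro continuous_intros)
  ultimately show thesis by (rule that)
qed

lemma continuous_on_annulus_weight: "continuous_on A (annulus_weight \<epsilon>)"
  unfolding annulus_weight_def[abs_def] by (intro continuous_intros)

text \<open>The primitive \<open>\<Phi>\<close> makes \<open>\<eta>(x) = \<Phi>(\<bar>x - a\<bar>\<^sup>2)\<close> a cutoff function that is constant near \<open>a\<close>
  and satisfies \<open>\<nabla>\<eta> = \<psi>(\<bar>x - a\<bar>\<^sup>2) (x - a)\<close>, where \<open>\<psi>\<close> is the weight. The factor 2 from
  differentiating the squared distance cancels against the \<open>1/2\<close>.\<close>

lemma annulus_weight_primitive:
  assumes "\<epsilon> > 0"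
  obtains \<Phi> where "\<And>t. (\<Phi> has_real_derivative annulus_weight \<epsilon> t / 2) (at t)"
    "\<And>t. t \<ge> \<epsilon> \<Longrightarrow> \<Phi> t = 0"
proof -
  let ?c = "\<epsilon>/2"
  let ?u = "\<lambda>t. ?c^3 - (max 0 (t - ?c))^3"
  have d3: "((\<lambda>t::real. (max 0 t)^3) has_real_derivative 3 * (max 0 t)\<^sup>2) (at t)" for t
    using DERIV_max_0_power[of 1 t] by (simp add: numeral_3_eq_3 numeral_2_eq_2)
  \<comment> \<open>The chain rule on the cube of \<open>max 0 (?u t)\<close> produces \<open>3 * (- 3) = - 9\<close> times the weight,
    hence the factor \<open>- 1/18\<close>.\<close>
  have "((\<lambda>t. - ((max 0 (?u t))^3) / 18) has_real_derivative annulus_weight \<epsilon> t / 2) (at t)" for t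
    using DERIV_cdivide[OF DERIV_minus[OF DERIV_chain2[OF d3 DERIV_annulus_weight_inner,
            of "?c^3" ?c t]], of 18]
    by (simp add: annulus_weight_def mult.commute)
  moreover have "- ((max 0 (?u t))^3) / 18 = 0" if "t \<ge> \<epsilon>" for t
  proof -
    have "?c^3 \<le> (t - ?c)^3" using assms that by (intro power_mono) auto
    then show ?thesis using that assms by (simp add: max_def)
  qed
  ultimately show thesis by (rule that)
qed

lemma compact_sqdist_regions:
  "compact {x :: 'a::euclidean_space. (x - a) \<bullet> (x - a) \<le> \<epsilon>}"
  "compact {x :: 'a::euclidean_space. \<epsilon>/2 \<le> (x - a) \<bullet> (x - a) \<and> (x - a) \<bullet> (x - a) \<le> \<epsilon>}"
proof -
  have "closed {x. (x - a) \<bullet> (x - a) \<le> \<epsilon>}"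
    by (intro closed_Collect_le continuous_intros)
  moreover have "{x. (x - a) \<bullet> (x - a) \<le> \<epsilon>} \<subseteq> cball a (sqrt \<epsilon>)"
  proof
    fix x assume "x \<in> {x. (x - a) \<bullet> (x - a) \<le> \<epsilon>}"
    then have "norm (x - a) \<le> sqrt \<epsilon>" by (simp add: norm_eq_sqrt_inner)
    then show "x \<in> cball a (sqrt \<epsilon>)" by (simp add: dist_norm norm_minus_commute)
  qed
  ultimately show 1: "compact {x. (x - a) \<bullet> (x - a) \<le> \<epsilon>}"
    using bounded_subset[OF bounded_cball] by (auto simp: compact_eq_bounded_closed)
  have "closed {x. \<epsilon>/2 \<le> (x - a) \<bullet> (x - a)}"
    by (intro closed_Collect_le continuous_intros)
  with 1 show "compact {x. \<epsilon>/2 \<le> (x - a) \<bullet> (x - a) \<and> (x - a) \<bullet> (x - a) \<le> \<epsilon>}"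
    by (simp add: Collect_conj_eq closed_Int_compact)
qed

section \<open>The Pohozaev identity\<close>

lemma continuous_has_antiderivative:
  fixes f :: "real \<Rightarrow> real"
  assumes "continuous_on UNIV f"
  obtains F where "\<And>x. (F has_real_derivative f x) (at x)"
proof -
  have "\<exists>F. \<forall>x::real. -\<infinity> < ereal x \<longrightarrow> ereal x < \<infinity> \<longrightarrow> (F has_vector_derivative f x) (at x)"
    by (rule einterval_antiderivative) (use assms in \<open>auto simp: continuous_on_eq_continuous_at\<close>)
  then show thesis using that by (auto simp: has_real_derivative_iff_has_vector_derivative)
qed

lemma UNIV_two:
  assumes "i \<noteq> j"
  shows "(UNIV :: 2 set) = {i, j}"
proof -
  have "x = i \<or> x = j" for x
    using assms exhaust_2[of i] exhaust_2[of j] exhaust_2[of x] by metis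
  then show ?thesis by auto
qed

lemma sqdist_two:
  fixes x a :: "real^2"
  shows "i \<noteq> j \<Longrightarrow> (x - a) \<bullet> (x - a) = (x $ i - a $ i)\<^sup>2 + (x $ j - a $ j)\<^sup>2"
  unfolding inner_vec_def by (simp add: UNIV_two[of i j] power2_eq_square)

lemma laplacian_two:
  "i \<noteq> j \<Longrightarrow> laplacian v x = partial i (partial i v) x + partial j (partial j v) (x :: real^2)"
  unfolding laplacian_def by (simp add: UNIV_two[of i j])

text \<open>With \<open>y = x - a\<close> and the trace-free tensor \<open>T\<^sub>i\<^sub>i = - T\<^sub>j\<^sub>j = ((\<partial>\<^sub>i v)\<^sup>2 - (\<partial>\<^sub>j v)\<^sup>2) / 2\<close>,
  \<open>T\<^sub>i\<^sub>j = \<partial>\<^sub>i v \<partial>\<^sub>j v\<close>, the first two terms are \<open>y\<^sub>i T\<^sub>i\<^sub>i + y\<^sub>j T\<^sub>i\<^sub>j\<close>. The third one contains the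
  angular derivative \<open>y\<^sub>i \<partial>\<^sub>j v - y\<^sub>j \<partial>\<^sub>i v\<close>; it stands for the contribution of the nonlinearity,
  written without its primitive.\<close>

definition pohozaev_density :: "2 \<Rightarrow> 2 \<Rightarrow> (real^2 \<Rightarrow> real) \<Rightarrow> real^2 \<Rightarrow> real^2 \<Rightarrow> real" where
  "pohozaev_density i j v a x =
    (x $ i - a $ i) * (((partial i v x)\<^sup>2 - (partial j v x)\<^sup>2) / 2)
    + (x $ j - a $ j) * (partial i v x * partial j v x)
    + (x $ j - a $ j) * laplacian v x
      * ((x $ i - a $ i) * partial j v x - (x $ j - a $ j) * partial i v x)"

text \<open>Let \<open>F' = f\<close>. The equation makes \<open>T + F(v) I\<close> divergence free, so integrating its \<open>i\<close>-th row
  against the gradient \<open>\<psi> y\<close> of the cutoff function gives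
  \<open>\<integral> \<psi> (y\<^sub>i T\<^sub>i\<^sub>i + y\<^sub>j T\<^sub>i\<^sub>j) + \<integral> \<psi> y\<^sub>i F(v) = 0\<close>. Nothing is known about the size of \<open>F(v)\<close> along
  a sequence of solutions, so it has to be removed. The rotation \<open>R = y\<^sub>i \<partial>\<^sub>j - y\<^sub>j \<partial>\<^sub>i\<close> is divergence free,
  kills radial functions and maps \<open>y\<^sub>j\<close> to \<open>y\<^sub>i\<close>; hence
  \<open>\<integral> \<psi> y\<^sub>i F(v) = - \<integral> \<psi> y\<^sub>j R(F(v)) = \<integral> \<psi> y\<^sub>j \<Delta>v R v\<close>. What remains involves derivatives of \<open>v\<close>
  on the annulus only.\<close>

lemma pohozaev_identity:
  fixes v :: "real^2 \<Rightarrow> real"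
  assumes U: "open U" and v: "Ck_on 2 v U"
    and f: "continuous_on UNIV f" and eq: "\<And>x. x \<in> U \<Longrightarrow> - laplacian v x = f (v x)"
    and \<epsilon>: "\<epsilon> > 0" "\<And>x. (x - a) \<bullet> (x - a) \<le> \<epsilon> \<Longrightarrow> x \<in> U"
    and ij: "i \<noteq> j"
  shows "has_bochner_integral lborel
    (\<lambda>x. annulus_weight \<epsilon> ((x - a) \<bullet> (x - a)) * pohozaev_density i j v a x) 0"
proof -
  obtain F where F: "\<And>t. (F has_real_derivative f t) (at t)"
    using continuous_has_antiderivative[OF f] by blast
  obtain \<Phi> where \<Phi>: "\<And>t. (\<Phi> has_real_derivative annulus_weight \<epsilon> t / 2) (at t)"
    "\<And>t. t \<ge> \<epsilon> \<Longrightarrow> \<Phi> t = 0"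
    using annulus_weight_primitive[OF \<epsilon>(1)] by blast
  obtain \<psi>' where \<psi>': "\<And>t. (annulus_weight \<epsilon> has_real_derivative \<psi>' t) (at t)" "continuous_on UNIV \<psi>'"
    using annulus_weight_C1 by blast
  define N where "N x = (x - a) \<bullet> (x - a)" for x
  define \<psi> where "\<psi> = annulus_weight \<epsilon>"
  define K where "K = {x. N x \<le> \<epsilon>}"
  have K: "compact K" "K \<subseteq> U" using \<epsilon> compact_sqdist_regions(1)[of a \<epsilon>] by (auto simp: K_def N_def)
  define p where "p k = partial k v" for k
  define pp where "pp k l = partial k (partial l v)" for k l
  have \<psi>0: "\<psi> (N x) = 0" "\<psi>' (N x) = 0" "\<Phi> (N x) = 0" if "x \<notin> K" for x
  proof -
    have t: "N x > \<epsilon>" using that by (simp add: K_def)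
    then show "\<psi> (N x) = 0" "\<Phi> (N x) = 0" using \<Phi>(2) annulus_weight_eq_0 \<epsilon> by (auto simp: \<psi>_def)
    have "((\<lambda>_. 0) has_real_derivative \<psi>' (N x)) (at (N x))"
      by (rule has_field_derivative_transform_within_open[OF \<psi>'(1), where S="{\<epsilon><..}"])
        (use t annulus_weight_eq_0 \<epsilon> in auto)
    then show "\<psi>' (N x) = 0" using DERIV_unique DERIV_const by blast
  qed
  have hp: "has_partial k v (p k x) x" "has_partial l (p k) (pp l k x) x" if "x \<in> U" for k l x
    using Ck_on_2D[OF v] that by (auto simp: p_def pp_def intro!: has_partial_partial)
  have DERIV_cont: "continuous_on S g" if "\<And>t. (g has_real_derivative g' t) (at t)"
    for g g' :: "real \<Rightarrow> real" and S
    using that by (blast intro: continuous_at_imp_continuous_on DERIV_isCont)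
  have Fc: "continuous_on S F" and \<Phi>c: "continuous_on S \<Phi>" and fc: "continuous_on S f"
    and \<psi>c: "continuous_on S \<psi>" and \<psi>'c: "continuous_on S \<psi>'" for S
    using f \<psi>'(2) DERIV_cont[of F, OF F] DERIV_cont[of \<Phi>, OF \<Phi>(1)] continuous_on_annulus_weight
    unfolding \<psi>_def by (auto intro: continuous_on_subset)
  have vc: "continuous_on U v" "\<And>k. continuous_on U (p k)" "\<And>k l. continuous_on U (pp k l)"
    using Ck_on_2D[OF v] by (auto simp: p_def pp_def)
  have sym: "pp i j x = pp j i x" if "x \<in> U" for x
    by (rule mixed_partials_eq[where u=v and p="p j" and q="p i", OF U that]) (auto intro: hp vc)
  have hN: "has_partial k N (2 * (x $ k - a $ k)) x" for k x
    using has_partial_sqdist by (simp add: N_def[abs_def])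
  have Nc: "continuous_on S N" for S unfolding N_def[abs_def] by (intro continuous_intros)
  note hc = has_partial_chain[OF hN \<Phi>(1)] has_partial_chain[OF hN \<psi>'(1)[folded \<psi>_def]]
  have comp: "continuous_on U (\<lambda>x. \<Phi> (N x))" "continuous_on U (\<lambda>x. \<psi> (N x))"
    "continuous_on U (\<lambda>x. \<psi>' (N x))" "continuous_on U (\<lambda>x. F (v x))" "continuous_on U (\<lambda>x. f (v x))"
    using continuous_on_compose2[OF \<Phi>c Nc[of U], of UNIV] continuous_on_compose2[OF \<psi>c Nc[of U], of UNIV]
      continuous_on_compose2[OF \<psi>'c Nc[of U], of UNIV] continuous_on_compose2[OF Fc vc(1), of UNIV]
      continuous_on_compose2[OF fc vc(1), of UNIV] by simp_all
  let ?y = "\<lambda>k x. x $ k - a $ k"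
  note cont = comp vc continuous_on_add continuous_on_diff continuous_on_mult continuous_on_power
    continuous_on_component continuous_on_const continuous_on_id continuous_on_divide
  \<comment> \<open>\<open>A\<close> and \<open>B\<close> integrate the divergence of the cutoff times the \<open>i\<close>-th row of the tensor;
    \<open>C\<close> and \<open>E\<close> integrate the rotation of \<open>\<psi> y\<^sub>j F(v)\<close>.\<close>
  have A: "has_bochner_integral lborel (\<lambda>x. \<psi> (N x) * ?y i x * (((p i x)\<^sup>2 - (p j x)\<^sup>2) / 2 + F (v x))
     + \<Phi> (N x) * (p i x * pp i i x - p j x * pp i j x + f (v x) * p i x)) 0"
  proof (rule has_bochner_integral_partial_zero[OF U K, where i=i and
        g="\<lambda>x. \<Phi> (N x) * (((p i x)\<^sup>2 - (p j x)\<^sup>2) * (1/2) + F (v x))"])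
    show "has_partial i (\<lambda>x. \<Phi> (N x) * (((p i x)\<^sup>2 - (p j x)\<^sup>2) * (1/2) + F (v x)))
      (\<psi> (N x) * ?y i x * (((p i x)\<^sup>2 - (p j x)\<^sup>2) / 2 + F (v x))
     + \<Phi> (N x) * (p i x * pp i i x - p j x * pp i j x + f (v x) * p i x)) x" if "x \<in> U" for x
      by (rule has_partial_eq, (rule has_partial_intros hc has_partial_chain[OF hp(1) F] hp that)+)
        (simp add: field_simps \<psi>_def)
  qed ((intro cont; simp) | simp add: \<psi>0)+
  have B: "has_bochner_integral lborel (\<lambda>x. \<psi> (N x) * ?y j x * (p i x * p j x)
     + \<Phi> (N x) * (pp j i x * p j x + p i x * pp j j x)) 0"
  proof (rule has_bochner_integral_partial_zero[OF U K, where i=j and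
        g="\<lambda>x. \<Phi> (N x) * (p i x * p j x)"])
    show "has_partial j (\<lambda>x. \<Phi> (N x) * (p i x * p j x)) (\<psi> (N x) * ?y j x * (p i x * p j x)
     + \<Phi> (N x) * (pp j i x * p j x + p i x * pp j j x)) x" if "x \<in> U" for x
      by (rule has_partial_eq, (rule has_partial_intros hc hp that)+)
        (simp add: field_simps \<psi>_def)
  qed ((intro cont; simp) | simp add: \<psi>0)+
  have C: "has_bochner_integral lborel (\<lambda>x. ?y i x * (2 * \<psi>' (N x) * ?y j x * ?y j x * F (v x)
     + \<psi> (N x) * F (v x) + \<psi> (N x) * ?y j x * f (v x) * p j x)) 0"
  proof (rule has_bochner_integral_partial_zero[OF U K, where i=j and
        g="\<lambda>x. ?y i x * (\<psi> (N x) * (?y j x * F (v x)))"])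
    show "has_partial j (\<lambda>x. ?y i x * (\<psi> (N x) * (?y j x * F (v x))))
      (?y i x * (2 * \<psi>' (N x) * ?y j x * ?y j x * F (v x)
     + \<psi> (N x) * F (v x) + \<psi> (N x) * ?y j x * f (v x) * p j x)) x" if "x \<in> U" for x
      by (rule has_partial_eq, (rule has_partial_intros hc has_partial_chain[OF hp(1) F] hp that)+)
        (use ij in \<open>simp add: algebra_simps\<close>)
  qed ((intro cont; simp) | simp add: \<psi>0)+
  have E: "has_bochner_integral lborel (\<lambda>x. ?y j x * (2 * \<psi>' (N x) * ?y i x * ?y j x * F (v x)
     + \<psi> (N x) * ?y j x * f (v x) * p i x)) 0"
  proof (rule has_bochner_integral_partial_zero[OF U K, where i=i and
        g="\<lambda>x. ?y j x * (\<psi> (N x) * (?y j x * F (v x)))"])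
    show "has_partial i (\<lambda>x. ?y j x * (\<psi> (N x) * (?y j x * F (v x))))
      (?y j x * (2 * \<psi>' (N x) * ?y i x * ?y j x * F (v x)
     + \<psi> (N x) * ?y j x * f (v x) * p i x)) x" if "x \<in> U" for x
      by (rule has_partial_eq, (rule has_partial_intros hc has_partial_chain[OF hp(1) F] hp that)+)
        (use ij in \<open>simp add: algebra_simps\<close>)
  qed ((intro cont; simp) | simp add: \<psi>0)+
  note has_bochner_integral_add[OF has_bochner_integral_diff[OF has_bochner_integral_add[OF A B] C] E]
  then show ?thesis
  proof (rule has_bochner_integral_cong[THEN iffD1, rotated -1])
    fix x
    show "\<psi> (N x) * ?y i x * (((p i x)\<^sup>2 - (p j x)\<^sup>2) / 2 + F (v x))
     + \<Phi> (N x) * (p i x * pp i i x - p j x * pp i j x + f (v x) * p i x)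
     + (\<psi> (N x) * ?y j x * (p i x * p j x) + \<Phi> (N x) * (pp j i x * p j x + p i x * pp j j x))
     - ?y i x * (2 * \<psi>' (N x) * ?y j x * ?y j x * F (v x)
     + \<psi> (N x) * F (v x) + \<psi> (N x) * ?y j x * f (v x) * p j x)
     + ?y j x * (2 * \<psi>' (N x) * ?y i x * ?y j x * F (v x) + \<psi> (N x) * ?y j x * f (v x) * p i x)
     = annulus_weight \<epsilon> ((x - a) \<bullet> (x - a)) * pohozaev_density i j v a x"
    proof (cases "x \<in> K")
      case False
      then show ?thesis using \<psi>0[OF False] by (simp add: \<psi>_def N_def)
    next
      case True
      then have x: "x \<in> U" using K by auto
      have f: "f (v x) = - (pp i i x + pp j j x)"
        using eq[OF x] by (simp add: laplacian_two[OF ij] pp_def)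
      show ?thesis
        unfolding pohozaev_density_def laplacian_two[OF ij]
          N_def[symmetric] \<psi>_def[symmetric] p_def[symmetric]
        unfolding p_def pp_def[symmetric] f sym[OF x] unfolding p_def[symmetric]
        by (simp add: field_simps power2_eq_square)
    qed
  qed auto
qed

section \<open>The logarithmic pole and the passage to the limit\<close>

lemma log_kernel:
  fixes a :: "real^'n::finite"
  defines "L \<equiv> \<lambda>x. ln (1 / norm (x - a))" and "N \<equiv> \<lambda>x. (x - a) \<bullet> (x - a)"
  shows log_kernel_C2: "Ck_on 2 L (- {a})"
    and partial_log_kernel: "x \<noteq> a \<Longrightarrow> partial i L x = - ((x $ i - a $ i) / N x)"
    and partial2_log_kernel: "x \<noteq> a \<Longrightarrow> partial j (partial i L) x =
      - ((if i = j then 1 else 0) / N x) + 2 * (x $ i - a $ i) * (x $ j - a $ j) / (N x)\<^sup>2"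
proof -
  have opn: "open (- {a})" by auto
  have N: "N x > 0" if "x \<noteq> a" for x using that by (simp add: N_def)
  have LN: "L x = - (1/2) * ln (N x)" if "x \<noteq> a" for x
    using that by (simp add: L_def N_def norm_eq_sqrt_inner ln_div ln_sqrt)
  have dN: "(N has_derivative (\<lambda>h. 2 * ((x - a) \<bullet> h))) (at x)" for x
    unfolding N_def by (auto intro!: derivative_eq_intros simp: inner_commute)
  have dL: "(L has_derivative (\<lambda>h. - (((x - a) \<bullet> h) / N x))) (at x)" if x: "x \<noteq> a" for x
  proof -
    have "((\<lambda>x. - (1/2) * ln (N x)) has_derivative (\<lambda>h. - (((x - a) \<bullet> h) / N x))) (at x)"
      using N[OF x] by (auto intro!: derivative_eq_intros dN simp: divide_simps)
    then show ?thesis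
      by (rule has_derivative_transform_within_open[OF _ opn]) (use x LN in auto)
  qed
  have dcoord: "((\<lambda>x. x $ k) has_derivative (\<lambda>h. h $ k)) (at x)" for k and x :: "real^'n"
    by (rule bounded_linear_imp_has_derivative[OF bounded_linear_vec_nth])
  define p where "p i x = - ((x $ i - a $ i) / N x)" for i x
  define q where "q j i x = - ((if i = j then 1 else 0) / N x) +
      2 * (x $ i - a $ i) * (x $ j - a $ j) / (N x)\<^sup>2" for j i x
  have p: "partial i L x = p i x" if "x \<noteq> a" for i x
    using partial_eqI[OF dL[OF that], of i] by (simp add: p_def inner_axis)
  have dp: "(p i has_derivative (\<lambda>h. - (h $ i / N x) +
      2 * (x $ i - a $ i) * ((x - a) \<bullet> h) / (N x)\<^sup>2)) (at x)" if x: "x \<noteq> a" for i x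
    unfolding p_def[abs_def] using N[OF x]
    by (auto intro!: derivative_eq_intros dN dcoord simp: divide_simps power2_eq_square algebra_simps)
  have dp': "(partial i L has_derivative (\<lambda>h. - (h $ i / N x) +
      2 * (x $ i - a $ i) * ((x - a) \<bullet> h) / (N x)\<^sup>2)) (at x)" if x: "x \<noteq> a" for i x
    by (rule has_derivative_transform_within_open[OF dp[OF x] opn]) (use x p in auto)
  have q: "partial j (partial i L) x = q j i x" if "x \<noteq> a" for j i x
    using partial_eqI[OF dp'[OF that], of j i]
    by (simp add: q_def inner_axis) (auto simp: axis_def)
  show "x \<noteq> a \<Longrightarrow> partial i L x = - ((x $ i - a $ i) / N x)"
    "x \<noteq> a \<Longrightarrow> partial j (partial i L) x =
      - ((if i = j then 1 else 0) / N x) + 2 * (x $ i - a $ i) * (x $ j - a $ j) / (N x)\<^sup>2"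
    using p q by (auto simp: p_def q_def)
  have "continuous_on (- {a}) (q j i)" for j i
    unfolding q_def[abs_def] N_def by (intro continuous_intros) auto
  then have "continuous_on (- {a}) (partial j (partial i L))" for j i
    using continuous_on_cong[of "- {a}" "- {a}" "q j i" "partial j (partial i L)"] q by auto
  moreover have "L differentiable (at x)" "partial i L differentiable (at x)" if "x \<noteq> a" for i x
    using dL[OF that] dp'[OF that] by (blast intro: differentiableI)+
  ultimately show "Ck_on 2 L (- {a})" by (simp add: numeral_2_eq_2)
qed

lemma laplacian_log_kernel:
  fixes a :: "real^2"
  assumes "x \<noteq> a"
  shows "laplacian (\<lambda>x. ln (1 / norm (x - a))) x = 0"
proof -
  have ne: "(1::2) \<noteq> 2" by simp
  have N: "(x - a) \<bullet> (x - a) = (x $ 1 - a $ 1)\<^sup>2 + (x $ 2 - a $ 2)\<^sup>2"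
    by (rule sqdist_two[OF ne])
  define M where "M = (x - a) \<bullet> (x - a)"
  have M: "M \<noteq> 0" using assms by (simp add: M_def)
  have "laplacian (\<lambda>x. ln (1 / norm (x - a))) x =
      2 * ((x $ 1 - a $ 1)\<^sup>2 + (x $ 2 - a $ 2)\<^sup>2) / M\<^sup>2 - 2 / M"
    using assms unfolding laplacian_two[OF ne] partial2_log_kernel[OF assms] M_def[symmetric]
    by (simp add: power2_eq_square add_divide_distrib diff_divide_distrib algebra_simps)
  also have "\<dots> = 0" unfolding N[symmetric] M_def[symmetric] using M by (simp add: power2_eq_square)
  finally show ?thesis .
qed

lemma continuous_on_pohozaev_density:
  assumes "Ck_on 2 v U"
  shows "continuous_on U (pohozaev_density i j v a)"
proof -
  note c = Ck_on_2D(4,5)[OF assms]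
  have "continuous_on U (laplacian v)"
    unfolding laplacian_def[abs_def] by (intro continuous_on_sum c)
  then show ?thesis unfolding pohozaev_density_def[abs_def] by (intro continuous_intros c) simp_all
qed

lemma uniform_limit_pohozaev_density:
  assumes conv: "C2_loc_convergent U w V" and K: "compact K" "K \<subseteq> U" and ij: "i \<noteq> j"
  shows "uniform_limit K (\<lambda>k. pohozaev_density i j (w k) a) (pohozaev_density i j V a) sequentially"
proof -
  have C: "continuous_on K (partial k V)" "continuous_on K (partial k (partial l V))" for k l
    using Ck_on_2D(4,5)[of V U] conv K unfolding C2_loc_convergent_def
    by (auto intro: continuous_on_subset)
  have L: "uniform_limit K (\<lambda>n. partial k (w n)) (partial k V) sequentially"
    "uniform_limit K (\<lambda>n. partial k (partial l (w n))) (partial k (partial l V)) sequentially" for k l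
    using conv K unfolding C2_loc_convergent_def by auto
  have y: "uniform_limit K (\<lambda>n x. x $ k - a $ k) (\<lambda>x. x $ k - a $ k) sequentially"
    "continuous_on K (\<lambda>x. x $ k - a $ k)" for k
    by (auto intro!: uniform_limit_const continuous_intros)
  note lims = uniform_limit_add uniform_limit_minus uniform_limit_mult_compact[OF K(1)] L y
    uniform_limit_const
  note conts = continuous_on_add continuous_on_diff continuous_on_mult C y continuous_on_const
  have "uniform_limit K (\<lambda>n x. (x $ i - a $ i) *
        ((partial i (w n) x * partial i (w n) x - partial j (w n) x * partial j (w n) x) * (1/2))
      + (x $ j - a $ j) * (partial i (w n) x * partial j (w n) x)
      + (x $ j - a $ j) * (partial i (partial i (w n)) x + partial j (partial j (w n)) x)
        * ((x $ i - a $ i) * partial j (w n) x - (x $ j - a $ j) * partial i (w n) x))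
    (\<lambda>x. (x $ i - a $ i) *
        ((partial i V x * partial i V x - partial j V x * partial j V x) * (1/2))
      + (x $ j - a $ j) * (partial i V x * partial j V x)
      + (x $ j - a $ j) * (partial i (partial i V) x + partial j (partial j V) x)
        * ((x $ i - a $ i) * partial j V x - (x $ j - a $ j) * partial i V x)) sequentially"
    by (intro lims conts)
  then show ?thesis
    by (simp add: pohozaev_density_def[abs_def] laplacian_two[OF ij] power2_eq_square)
qed

text \<open>The pole enters through \<open>V = h + c log (1/\<bar>y\<bar>)\<close>, that is \<open>\<nabla>V = \<nabla>h - c y / \<bar>y\<bar>\<^sup>2\<close>. The part
  quadratic in the pole is odd. In the part bilinear in the pole and \<open>h\<close> the singularity cancels
  and leaves exactly \<open>- c \<partial>\<^sub>i h\<close>. The angular derivative and the Laplacian do not see the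
  pole, because the logarithm is radial and harmonic.\<close>

lemma pohozaev_density_log_shift:
  fixes h V :: "real^2 \<Rightarrow> real"
  assumes x: "x \<noteq> a" and ij: "i \<noteq> j"
    and V: "\<And>k. partial k V x = partial k h x - c * ((x $ k - a $ k) / ((x - a) \<bullet> (x - a)))"
    and lap: "laplacian V x = laplacian h x"
  shows "pohozaev_density i j V a x =
    c\<^sup>2 / 2 * ((x $ i - a $ i) / ((x - a) \<bullet> (x - a))) - c * partial i h x + pohozaev_density i j h a x"
proof -
  define N where "N = (x - a) \<bullet> (x - a)"
  define u where "u = c / N"
  have N: "N \<noteq> 0" using x by (simp add: N_def)
  have N': "N = (x $ i - a $ i)\<^sup>2 + (x $ j - a $ j)\<^sup>2" unfolding N_def by (rule sqdist_two[OF ij])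
  have c: "c = u * ((x $ i - a $ i)\<^sup>2 + (x $ j - a $ j)\<^sup>2)" using N unfolding N'[symmetric] u_def by simp
  have P: "partial k V x = partial k h x - u * (x $ k - a $ k)" for k
    by (simp add: V u_def N_def)
  have 1: "c\<^sup>2 / 2 * ((x $ i - a $ i) / N) = c * u * (x $ i - a $ i) / 2"
    by (simp add: u_def power2_eq_square)
  show ?thesis
    unfolding N_def[symmetric] 1 pohozaev_density_def P lap
    by (subst (1 2) c) (simp add: field_simps power2_eq_square)
qed

text \<open>Passing to the limit in the Pohozaev identity and discarding the odd part coming from the pole
  leaves \<open>\<integral> \<psi> (- c \<partial>\<^sub>i h + Q) = 0\<close>, where \<open>Q\<close>, the Pohozaev density of \<open>h\<close>, is continuous and vanishes
  at \<open>a\<close>. If \<open>\<partial>\<^sub>i h a\<close> were nonzero, the bracket would have a fixed sign near \<open>a\<close>; taking the annulus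
  that small contradicts the vanishing of the integral.\<close>

lemma regular_gradient_zero:
  fixes v :: "nat \<Rightarrow> real^2 \<Rightarrow> real" and h V :: "real^2 \<Rightarrow> real"
  assumes U: "open U" "a \<in> U" and ij: "i \<noteq> j"
    and v: "\<And>k. Ck_on 2 (v k) U" and f: "\<And>k. continuous_on UNIV (f k)"
    and eq: "\<And>k x. x \<in> U \<Longrightarrow> - laplacian (v k) x = f k (v k x)"
    and conv: "C2_loc_convergent (U - {a}) v V"
    and h: "Ck_on 2 h U" and c: "c \<noteq> 0"
    and V: "\<And>x. x \<in> U - {a} \<Longrightarrow> V x = h x + c * ln (1 / norm (x - a))"
  shows "partial i h a = 0"
proof (rule ccontr)
  assume ne: "partial i h a \<noteq> 0"
  \<comment> \<open>The part of the Pohozaev density of \<open>V\<close> that is left after dropping the odd term.\<close>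
  define B where "B x = pohozaev_density i j h a x - c * partial i h x" for x
  define N where "N x = (x - a) \<bullet> (x - a)" for x
  have Bc: "continuous_on U B"
    unfolding B_def[abs_def]
    by (intro continuous_intros continuous_on_pohozaev_density[OF h] Ck_on_2D(4)[OF h])
  have Ba: "B a = - c * partial i h a" by (simp add: B_def pohozaev_density_def)
  \<comment> \<open>Multiplying by the sign of \<open>B a\<close> treats both signs at once.\<close>
  define \<sigma> where "\<sigma> = sgn (B a)"
  have \<sigma>: "\<sigma> * B a > 0" using ne c Ba by (simp add: \<sigma>_def sgn_mult_abs mult.commute[of "sgn _"] flip: abs_sgn)
  have "open {x \<in> U. \<sigma> * B x > 0}"
    using continuous_open_preimage[OF continuous_on_mult[OF continuous_on_const Bc, of \<sigma>] U(1) open_greaterThan[of 0]]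
    by (simp add: vimage_def Int_def)
  then obtain d where d: "d > 0" "ball a d \<subseteq> {x \<in> U. \<sigma> * B x > 0}"
    using \<sigma> U(2) openE[of "{x \<in> U. \<sigma> * B x > 0}" a] by blast
  define \<epsilon> where "\<epsilon> = (d / 2)\<^sup>2"
  have \<epsilon>: "\<epsilon> > 0" using d by (simp add: \<epsilon>_def)
  have inball: "x \<in> U \<and> \<sigma> * B x > 0" if "N x \<le> \<epsilon>" for x
  proof -
    have "norm (x - a) \<le> d / 2"
      using that d(1) unfolding N_def \<epsilon>_def dot_square_norm by (simp add: power2_le_iff_abs_le)
    then have "x \<in> ball a d" using d(1) by (simp add: dist_norm norm_minus_commute)
    then show ?thesis using d(2) by auto
  qed
  define \<psi> where "\<psi> x = annulus_weight \<epsilon> (N x)" for x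
  define K where "K = {x. \<epsilon>/2 \<le> N x \<and> N x \<le> \<epsilon>}"
  have K: "compact K" using compact_sqdist_regions(2)[of \<epsilon> a] by (simp add: K_def N_def)
  have KU: "K \<subseteq> U - {a}" using inball \<epsilon> by (auto simp: K_def N_def)
  have \<psi>0: "\<psi> x = 0" if "x \<notin> K" for x
    using that annulus_weight_eq_0[OF \<epsilon>] by (force simp: K_def \<psi>_def)
  have Nc: "continuous_on S N" for S unfolding N_def[abs_def] by (intro continuous_intros)
  have \<psi>c: "continuous_on S \<psi>" for S
    unfolding \<psi>_def[abs_def] by (rule continuous_on_compose2[OF continuous_on_annulus_weight Nc]) auto
  have V2: "Ck_on 2 V (U - {a})" using conv by (simp add: C2_loc_convergent_def)
  note pc = continuous_on_pohozaev_density[THEN continuous_on_subset]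
  \<comment> \<open>The weight vanishes near \<open>a\<close>, so only the convergence away from the pole matters here.\<close>
  have VI: "has_bochner_integral lborel (\<lambda>x. \<psi> x * pohozaev_density i j V a x) 0"
  proof (rule has_bochner_integral_zero_uniform_limit[OF K])
    show "uniform_limit K (\<lambda>k x. \<psi> x * pohozaev_density i j (v k) a x)
        (\<lambda>x. \<psi> x * pohozaev_density i j V a x) sequentially"
      by (intro uniform_limit_mult_compact[OF K] uniform_limit_const \<psi>c
          uniform_limit_pohozaev_density[OF conv K KU ij] pc[OF V2 KU])
    show "continuous_on K (\<lambda>x. \<psi> x * pohozaev_density i j (v k) a x)" for k
      by (intro continuous_on_mult \<psi>c pc[OF v]) (use KU in auto)
    show "integral\<^sup>L lborel (\<lambda>x. \<psi> x * pohozaev_density i j (v k) a x) = 0" for k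
    proof -
      have "has_bochner_integral lborel
          (\<lambda>x. annulus_weight \<epsilon> ((x - a) \<bullet> (x - a)) * pohozaev_density i j (v k) a x) 0"
        by (rule pohozaev_identity[OF U(1) v f[of k] eq \<epsilon> _ ij])
          (use inball in \<open>auto simp: N_def\<close>)
      then show ?thesis by (simp add: \<psi>_def N_def has_bochner_integral_iff)
    qed
  qed (simp_all add: \<psi>0)
  \<comment> \<open>The contribution of the pole alone, up to a constant; it is odd under reflection at \<open>a\<close>.\<close>
  define odd where "odd x = \<psi> x * ((x $ i - a $ i) / N x)" for x
  have odd_cont: "continuous_on K odd"
    unfolding odd_def[abs_def] by (intro continuous_intros \<psi>c Nc) (use \<epsilon> in \<open>auto simp: K_def\<close>)
  have odd_int: "integrable lborel odd"
    by (rule integrable_compact_support[OF K odd_cont]) (simp add: odd_def \<psi>0)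
  have "integral\<^sup>L lborel odd = 0"
  proof (rule integral_odd_zero[where a=a])
    show "odd \<in> borel_measurable borel" using odd_int by (auto dest: borel_measurable_integrable)
    have "N (2 *\<^sub>R a - x) = N x" for x
    proof -
      have "2 *\<^sub>R a - x - a = - (x - a)" by (simp add: scaleR_2)
      then show ?thesis unfolding N_def by (simp only: inner_minus_left inner_minus_right minus_minus)
    qed
    moreover have "(2 *\<^sub>R a - x) $ i - a $ i = - (x $ i - a $ i)" for x by simp
    ultimately show "odd (2 *\<^sub>R a - x) = - odd x" for x
      by (simp only: odd_def \<psi>_def minus_divide_left[symmetric] mult_minus_right)
  qed
  with odd_int have odd_0: "has_bochner_integral lborel odd 0" by (simp add: has_bochner_integral_iff)
  have expand: "\<psi> x * pohozaev_density i j V a x = c\<^sup>2 / 2 * odd x + \<psi> x * B x" for x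
  proof (cases "x \<in> K")
    case False then show ?thesis by (simp add: odd_def \<psi>0)
  next
    case True
    then have x: "x \<in> U - {a}" using KU by auto
    let ?L = "\<lambda>x. ln (1 / norm (x - a))"
    have opn: "open (U - {a})" using U by auto
    have h': "Ck_on 2 h (U - {a})" by (rule Ck_on_subset[OF h]) auto
    have L': "Ck_on 2 ?L (U - {a})" by (rule Ck_on_subset[OF log_kernel_C2]) auto
    note dh = Ck_on_2D(1,2)[OF h'] and dL = Ck_on_2D(1,2)[OF L'] and dV = Ck_on_2D(1,2)[OF V2]
    have dcL: "(\<lambda>x. c * ?L x) differentiable (at x)" "(\<lambda>x. c * partial k ?L x) differentiable (at x)"
      if "x \<in> U - {a}" for k x
      using dL[OF that] by (auto intro: differentiable_mult differentiable_const)
    have pV: "partial k V x = partial k h x + c * partial k ?L x" if x: "x \<in> U - {a}" for k x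
      using partial_cong_open[OF opn x V dV(1)[OF x]]
      by (simp add: partial_add[OF dh(1)[OF x] dcL(1)[OF x]] partial_cmult[OF dL(1)[OF x]])
    have "partial k (partial k V) x = partial k (partial k h) x + c * partial k (partial k ?L) x" for k
      using partial_cong_open[OF opn x pV dV(2)[OF x]]
      by (simp add: partial_add[OF dh(2)[OF x] dcL(2)[OF x]] partial_cmult[OF dL(2)[OF x]])
    then have "laplacian V x = laplacian h x + c * laplacian ?L x"
      by (simp add: laplacian_two[OF ij] algebra_simps)
    then have lap: "laplacian V x = laplacian h x" using laplacian_log_kernel[of x a] x by simp
    have "partial k V x = partial k h x - c * ((x $ k - a $ k) / ((x - a) \<bullet> (x - a)))" for k
      using pV[OF x] partial_log_kernel[of x a k] x by simp
    from pohozaev_density_log_shift[OF _ ij this lap] x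
    have "pohozaev_density i j V a x = c\<^sup>2 / 2 * ((x $ i - a $ i) / N x) + B x"
      by (simp add: B_def N_def)
    then show ?thesis unfolding odd_def by (simp only: distrib_left mult.left_commute)
  qed
  have "has_bochner_integral lborel
      (\<lambda>x. \<sigma> * (\<psi> x * pohozaev_density i j V a x - c\<^sup>2 / 2 * odd x)) (\<sigma> * (0 - c\<^sup>2 / 2 * 0))"
    by (intro has_bochner_integral_mult_right has_bochner_integral_diff VI odd_0)
  then have BI: "has_bochner_integral lborel (\<lambda>x. \<psi> x * (\<sigma> * B x)) 0"
    by (simp add: expand algebra_simps)
  have nonneg: "\<psi> x * (\<sigma> * B x) \<ge> 0" for x
  proof (cases "x \<in> K")
    case True
    then have "\<sigma> * B x > 0" using inball by (auto simp: K_def)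
    then show ?thesis using annulus_weight_nonneg by (simp add: \<psi>_def)
  qed (simp add: \<psi>0)
  let ?T = "{x. \<epsilon>/2 < N x \<and> N x < \<epsilon>}"
  have T: "open ?T" unfolding Collect_conj_eq
    by (intro open_Int open_Collect_less Nc continuous_on_const)
  \<comment> \<open>Any squared distance strictly between \<open>\<epsilon>/2\<close> and \<open>\<epsilon>\<close> serves to show that the annulus is nonempty.\<close>
  have "a + axis i (sqrt (3/4 * \<epsilon>)) \<in> ?T"
    using \<epsilon> by (simp add: N_def inner_axis_axis)
  from nonneg_integral_zero_imp_zero_in_open[OF BI nonneg T this]
  obtain y where y: "y \<in> ?T" "\<psi> y * (\<sigma> * B y) = 0" by auto
  have "\<psi> y > 0" using y annulus_weight_pos[of \<epsilon> "N y"] by (simp add: \<psi>_def)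
  moreover have "\<sigma> * B y > 0" using y inball[of y] by simp
  ultimately have "\<psi> y * (\<sigma> * B y) > 0" by (rule mult_pos_pos)
  then show False using y(2) by simp
qed

section \<open>The location of blowup points\<close>

text \<open>The parameter \<open>\<alpha>\<close> ranges over \<open>{-1..1}\<close>, so dominated convergence applies along any convergent
  sequence of arguments. For \<open>Z = 0\<close> the integrand is zero by the
  convention on division.\<close>

lemma continuous_on_integral_exp:
  assumes "borel_probability_on_interval P"
  shows "continuous_on UNIV (\<lambda>s. LINT \<alpha>|P. \<alpha> * exp (\<alpha> * s) / Z)"
proof -
  interpret prob_space P using assms by (simp add: borel_probability_on_interval_def)
  have sets: "sets P = sets (restrict_space borel {-1..1})"
    using assms by (simp add: borel_probability_on_interval_def)
  have sp: "space P = {-1..1}" using sets_eq_imp_space_eq[OF sets] by (simp add: space_restrict_space)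
  have meas: "f \<in> borel_measurable P" if "f \<in> borel_measurable borel" for f :: "real \<Rightarrow> real"
    using measurable_restrict_space1[OF that, of "{-1..1}"] measurable_cong_sets[OF sets refl] by blast
  show ?thesis
  proof (rule continuous_at_imp_continuous_on, rule ballI)
    fix s :: real
    show "isCont (\<lambda>s. LINT \<alpha>|P. \<alpha> * exp (\<alpha> * s) / Z) s"
      unfolding continuous_at_sequentially o_def
    proof (intro allI impI)
      fix X :: "nat \<Rightarrow> real" assume X: "X \<longlonglongrightarrow> s"
      then obtain M where M: "\<And>n. \<bar>X n\<bar> \<le> M"
        using convergent_imp_Bseq[of X] by (auto simp: convergent_def Bseq_def)
      show "(\<lambda>n. LINT \<alpha>|P. \<alpha> * exp (\<alpha> * X n) / Z) \<longlonglongrightarrow> (LINT \<alpha>|P. \<alpha> * exp (\<alpha> * s) / Z)"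
      proof (rule integral_dominated_convergence[where w="\<lambda>_. exp M / \<bar>Z\<bar>"])
        show "AE \<alpha> in P. (\<lambda>n. \<alpha> * exp (\<alpha> * X n) / Z) \<longlonglongrightarrow> \<alpha> * exp (\<alpha> * s) / Z"
          by (intro AE_I2) (cases "Z = 0"; auto intro!: tendsto_intros X)
        show "AE \<alpha> in P. norm (\<alpha> * exp (\<alpha> * X n) / Z) \<le> exp M / \<bar>Z\<bar>" for n
        proof (rule AE_I2)
          fix \<alpha> assume "\<alpha> \<in> space P"
          then have \<alpha>: "\<bar>\<alpha>\<bar> \<le> 1" by (auto simp: sp)
          have "\<bar>\<alpha> * X n\<bar> \<le> 1 * M" unfolding abs_mult by (intro mult_mono \<alpha> M) auto
          then have "exp (\<alpha> * X n) \<le> exp M" by simp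
          then have "\<bar>\<alpha>\<bar> * exp (\<alpha> * X n) \<le> 1 * exp M" using \<alpha> by (intro mult_mono) auto
          then show "norm (\<alpha> * exp (\<alpha> * X n) / Z) \<le> exp M / \<bar>Z\<bar>"
            by (simp add: abs_mult divide_right_mono)
        qed
      qed (auto intro!: meas)
    qed
  qed
qed

theorem theorem2:
  fixes \<Omega> :: "(real^2) set" and P :: "real measure"
    and G H :: "real^2 \<Rightarrow> real^2 \<Rightarrow> real"
    and lam :: "nat \<Rightarrow> real" and lam0 :: real
    and v :: "nat \<Rightarrow> real^2 \<Rightarrow> real"
    and r :: "nat \<Rightarrow> nat" and w :: "nat \<Rightarrow> real^2 \<Rightarrow> real"
    and \<nu>p \<nu>m :: "(real^2) measure"
    and S :: "(real^2) set" and mp mm :: "real^2 \<Rightarrow> real"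
  assumes domain: "bounded_smooth_domain \<Omega>"
    and prob: "borel_probability_on_interval P"
    and green: "green_function \<Omega> G"
    and regular: "regular_part \<Omega> G H"
    and lam_pos: "\<And>k. lam k > 0"
    and lam_lim: "lam \<longlonglongrightarrow> lam0" "lam0 \<ge> 0"
    and sol: "\<And>k. classical_solution \<Omega> P (lam k) (v k)"
    and unbounded: "limsup (\<lambda>k. SUP x\<in>\<Omega>. ereal \<bar>v k x\<bar>) = \<infinity>"
    and subseq: "strict_mono r" and w_def: "w = v \<circ> r"
    and S_def: "S = blowup_set \<Omega> w"
    and nu_plus: "weak_star_convergent (closure \<Omega>)
          (\<lambda>k. mass_measure \<Omega> P {0..1} (lam (r k)) (w k)) \<nu>p"
    and nu_minus: "weak_star_convergent (closure \<Omega>)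
          (\<lambda>k. mass_measure \<Omega> P {-1..<0} (lam (r k)) (w k)) \<nu>m"
    and mp_def: "\<And>x. mp x = measure \<nu>p {x}"
    and mm_def: "\<And>x. mm x = measure \<nu>m {x}"
    and S_fin: "S \<noteq> {}" "finite S" "S \<subseteq> \<Omega>"
    and conv: "C2_loc_convergent (\<Omega> - S) w (\<lambda>x. \<Sum>x'\<in>S. (mp x' - mm x') * G x x')"
    and quad: "\<And>x0. x0 \<in> S \<Longrightarrow>
          (mp x0 - mm x0)\<^sup>2 =
            8 * pi * (beta_plus \<Omega> P w x0 * mp x0 + beta_minus \<Omega> P w x0 * mm x0)"
    and mass_neq: "\<And>x0. x0 \<in> S \<Longrightarrow> mp x0 \<noteq> mm x0"
  shows "\<forall>x0\<in>S.
    GDERIV (\<lambda>x. H x x0 + (\<Sum>x'\<in>S - {x0}. (mp x' - mm x') / (mp x0 - mm x0) * G x x')) x0 :> 0"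
proof
  fix a assume a: "a \<in> S"
  let ?m = "\<lambda>x. mp x - mm x"
  let ?V = "\<lambda>x. \<Sum>x'\<in>S. ?m x' * G x x'"
  let ?g = "\<lambda>x. H x a + (\<Sum>x'\<in>S - {a}. ?m x' / ?m a * G x x')"
  define U where "U = \<Omega> - (S - {a})"
  define h where "h x = ?m a * ?g x" for x
  have m: "?m a \<noteq> 0" using mass_neq[OF a] by simp
  have \<Omega>: "open \<Omega>" using domain by (simp add: bounded_smooth_domain_def)
  have fin: "finite (S - {a})" using S_fin(2) by simp
  have U: "open U" "a \<in> U" "U \<subseteq> \<Omega>" "U - {a} = \<Omega> - S"
    using \<Omega> fin a S_fin by (auto simp: U_def intro!: open_Diff finite_imp_closed)
  have H2: "Ck_on 2 (\<lambda>x. H x y) \<Omega>" if "y \<in> S" for y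
    using regular that S_fin(3) by (auto simp: regular_part_def smooth_on_def)
  have G_eq: "G x y = H x y + 1 / (2 * pi) * ln (1 / norm (x - y))"
    if "y \<in> S" "x \<in> \<Omega> - {y}" for x y
    using regular that S_fin(3) by (auto simp: regular_part_def)
  have G2: "Ck_on 2 (\<lambda>x. G x y) U" if y: "y \<in> S - {a}" for y
  proof (rule Ck_on_cong[OF U(1)])
    show "Ck_on 2 (\<lambda>x. H x y + 1 / (2 * pi) * ln (1 / norm (x - y))) U"
      by (intro Ck_on_add Ck_on_cmult U(1) Ck_on_subset[OF H2 U(3)]
          Ck_on_subset[OF log_kernel_C2[of y]]) (use y in \<open>auto simp: U_def\<close>)
    show "H x y + 1 / (2 * pi) * ln (1 / norm (x - y)) = G x y" if "x \<in> U" for x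
    proof -
      have "x \<noteq> y" "x \<in> \<Omega>" using that y by (auto simp: U_def)
      then show ?thesis using G_eq[of y x] y by simp
    qed
  qed
  have g2: "Ck_on 2 ?g U"
    by (intro Ck_on_add Ck_on_sum Ck_on_cmult G2 U(1) fin Ck_on_subset[OF H2[OF a] U(3)])
  then have h2: "Ck_on 2 h U"
    unfolding h_def[abs_def] by (rule Ck_on_cmult[OF U(1)])
  \<comment> \<open>Only the Green function with pole \<open>a\<close> is singular in \<open>U\<close>; the others are absorbed into \<open>h\<close>.\<close>
  have V: "?V x = h x + ?m a / (2 * pi) * ln (1 / norm (x - a))" if x: "x \<in> U - {a}" for x
  proof -
    have "?V x = ?m a * G x a + (\<Sum>x'\<in>S - {a}. ?m x' * G x x')"
      by (rule sum.remove[OF S_fin(2) a])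
    also have "(\<Sum>x'\<in>S - {a}. ?m x' * G x x') = ?m a * (\<Sum>x'\<in>S - {a}. ?m x' / ?m a * G x x')"
      unfolding sum_distrib_left by (rule sum.cong) (use m in auto)
    also have "G x a = H x a + 1 / (2 * pi) * ln (1 / norm (x - a))"
      by (rule G_eq[OF a]) (use x U(3) in auto)
    finally show ?thesis by (simp add: h_def algebra_simps)
  qed
  have C: "Ck_on 2 (w k) U" for k
    using sol[of "r k"] Ck_on_subset[OF _ U(3)] by (simp add: classical_solution_def w_def)
  have eq: "- laplacian (w k) x =
      lam (r k) * (LINT \<alpha>|P. \<alpha> * exp (\<alpha> * w k x) / partition_integral \<Omega> P (w k))"
    if "x \<in> U" for k x
    using sol[of "r k"] that U(3) by (auto simp: classical_solution_def w_def)
  have f: "continuous_on UNIV (\<lambda>s. lam (r k) *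
      (LINT \<alpha>|P. \<alpha> * exp (\<alpha> * s) / partition_integral \<Omega> P (w k)))" for k
    by (intro continuous_on_mult continuous_on_const continuous_on_integral_exp[OF prob])
  have ph: "partial i h a = 0" for i
  proof -
    obtain j :: 2 where ij: "i \<noteq> j" by (metis zero_neq_one)
    show ?thesis
      by (rule regular_gradient_zero[OF U(1,2) ij C f eq _ h2 _ V])
        (use conv m U(4) in auto)
  qed
  show "GDERIV ?g a :> 0"
  proof (rule GDERIV_zero_if_partials_zero)
    show dg: "?g differentiable (at a)" by (rule Ck_on_2D(1)[OF g2 U(2)])
    show "partial i ?g a = 0" for i
      using ph[of i] partial_cmult[OF dg, of i "?m a"] m by (simp add: h_def[abs_def])
  qed
qed

end
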